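(* Let $n\ge 1$, let $T'\in\mathcal{T}_n$ with corresponding web $w'=\psi(T')$, and write $\phi(v_{T'})=\sum_{w\in\mathcal{W}_n}c_w^{w'}w$. For every web $v\in\mathcal{W}_n$, if $c_v^{w'}\ne 0$ then there is a directed path from $v$ to $w'$ in the web graph, namely $v\preceq w'$.
   Context: $\mathcal{T}_n$ is the set of standard Young tableaux of shape $(n,n)$ ($2\times n$ fillings with $1,\dots,2n$, increasing along rows and down columns). $s_i\in S_{2n}$ is the transposition of $i$ and $i+1$; $S_{2n}$ acts on tableaux by permuting entries. Specht module: a tabloid $\{T\}$ is the equivalence class of a tableau $T$ under reordering entries within rows. For any tableau $T$ of shape $(n,n)$, $v_T=\sum_{\sigma\in Col(T)}\mathrm{sign}(\sigma)\{\sigma\cdot T\}$, where $Col(T)$ is the group of permutations preserving each column of $T$ setwise. $V^{\mathcal{T}_n}$ is the complex span of all the $v_T$; it has basis $\{v_T: T\in\mathcal{T}_n\}$, and $\sigma\cdot v_T=v_{\sigma\cdot T}$. A web on $2n$ points is a noncrossing perfect matching of $1,\dots,2n$ (arcs above a horizontal axis); $(i,j)$ denotes an arc with endpoints $i<j$, and $\{i,j\}$ an arc whose endpoints are not necessarily listed in order. $\mathcal{W}_n$ is the set of webs and $V^{\mathcal{W}_n}$ the complex vector space with basis $\mathcal{W}_n$, with the $S_{2n}$-action: $s_i\cdot w=-w$ if $(i,i+1)$ is an arc of $w$; otherwise, if $w$ contains $\{i,j\}$ and $\{i+1,k\}$, then $s_i\cdot w=w+w'$ where $w'$ is obtained from $w$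 by replacing these two arcs by $(i,i+1)$ and $\{j,k\}$. Tableau graph: directed graph on $\mathcal{T}_n$ with an edge $T\stackrel{s_i}{\longrightarrow}T'$ iff $s_i\cdot T=T'$ and $i$ is in the second row and $i+1$ in the first row of $T$. Web graph: directed graph on $\mathcal{W}_n$ with an edge $w\stackrel{s_i}{\longrightarrow}w'$ iff $s_i\cdot w=w+w'$ and $w$ contains arcs $(j,i)$ and $(i+1,k)$ with $j<i<i+1<k$. $w\preceq w'$ means there is a (possibly empty) directed path from $w$ to $w'$ in the web graph. The bijection $\psi:\mathcal{T}_n\to\mathcal{W}_n$: process the bottom row of $T$ from left to right, joining each entry's vertex by an arc to the nearest not-yet-matched vertex to its left. $T_0\in\mathcal{T}_n$ has top row $1,3,\dots,2n-1$ and bottom row $2,4,\dots,2n$; $w_0$ is the web with arcs $(1,2),(3,4),\dots,(2n-1,2n)$. The linear map $\phi:V^{\mathcal{T}_n}\to V^{\mathcal{W}_n}$ is defined by $\phi(v_T)=\sigma\cdot w_0$, where $\sigma$ is the product of the edge labels of a directed path from $T_0$ to $T$ in the tableau graph, composed so that $\sigma\cdot T_0=T$ (the label of the first edge acts first); such a path always exists and the result does not depend on its choice. *)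

theory Defs
  imports
    Complex_Main
    "HOL-Library.Poly_Mapping"
    "HOL-Library.FuncSet"
    "HOL-Library.Disjoint_Sets"
    "HOL-Combinatorics.Permutations"
begin

section \<open>Free complex vector spaces\<close>

text \<open>The complex vector space with basis the type of \<open>'a\<close> is \<open>'a \<Rightarrow>\<^sub>0 complex\<close>; the basis vector
  of \<open>a\<close> is \<open>Poly_Mapping.single a 1\<close> and the coefficient of \<open>a\<close> in \<open>x\<close> is \<open>Poly_Mapping.lookup x a\<close>.\<close>

definition fscale :: "complex \<Rightarrow> ('a \<Rightarrow>\<^sub>0 complex) \<Rightarrow> ('a \<Rightarrow>\<^sub>0 complex)" where
  "fscale c x = Poly_Mapping.map (\<lambda>z. c * z) x"

lemma lookup_fscale [simp]: "Poly_Mapping.lookup (fscale c x) a = c * Poly_Mapping.lookup x a"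
  by (simp add: fscale_def Poly_Mapping.map.rep_eq when_def)

global_interpretation free: vector_space fscale
  by unfold_locales (auto intro!: poly_mapping_eqI simp: lookup_add algebra_simps)


section \<open>Tableaux of shape \<open>(n, n)\<close>\<close>

text \<open>A cell is a pair (row, column); row 1 is the top row and row 2 the bottom row. Tableaux take
  the value 0 off the shape, so that equality of tableaux is equality of functions. Since a
  permutation of \<open>{1..2 * n}\<close> fixes 0, it acts on tableaux by composition \<open>\<sigma> \<circ> T\<close>.\<close>

type_synonym tableau = "nat \<times> nat \<Rightarrow> nat"

definition cells :: "nat \<Rightarrow> (nat \<times> nat) set" where
  "cells n = {1, 2} \<times> {1..n}"

definition tableaux :: "nat \<Rightarrow> tableau set" where
  "tableaux n = {T. bij_betw T (cells n) {1..2 * n} \<and> (\<forall>x. x \<notin> cells n \<longrightarrow> T x = 0)}"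

definition row :: "nat \<Rightarrow> tableau \<Rightarrow> nat \<Rightarrow> nat set" where
  "row n T r = (\<lambda>c. T (r, c)) ` {1..n}"

definition column :: "tableau \<Rightarrow> nat \<Rightarrow> nat set" where
  "column T c = {T (1, c), T (2, c)}"

definition SYT :: "nat \<Rightarrow> tableau set" where
  "SYT n = {T \<in> tableaux n. (\<forall>r\<in>{1, 2}. strict_mono_on {1..n} (\<lambda>c. T (r, c))) \<and>
                             (\<forall>c\<in>{1..n}. T (1, c) < T (2, c))}"


section \<open>The Specht module\<close>

definition Row :: "nat \<Rightarrow> tableau \<Rightarrow> (nat \<Rightarrow> nat) set" where
  "Row n T = {\<sigma>. \<sigma> permutes {1..2 * n} \<and> (\<forall>r\<in>{1, 2}. \<sigma> ` row n T r = row n T r)}"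

definition Col :: "nat \<Rightarrow> tableau \<Rightarrow> (nat \<Rightarrow> nat) set" where
  "Col n T = {\<sigma>. \<sigma> permutes {1..2 * n} \<and> (\<forall>c\<in>{1..n}. \<sigma> ` column T c = column T c)}"

definition tabloid :: "nat \<Rightarrow> tableau \<Rightarrow> tableau set" where
  "tabloid n T = (\<lambda>\<sigma>. \<sigma> \<circ> T) ` Row n T"

definition polytabloid :: "nat \<Rightarrow> tableau \<Rightarrow> (tableau set \<Rightarrow>\<^sub>0 complex)" where
  "polytabloid n T =
     (\<Sum>\<sigma>\<in>Col n T. Poly_Mapping.single (tabloid n (\<sigma> \<circ> T)) (of_int (sign \<sigma>)))"

definition specht :: "nat \<Rightarrow> (tableau set \<Rightarrow>\<^sub>0 complex) set" where
  "specht n = free.span (polytabloid n ` tableaux n)"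


section \<open>Webs\<close>

text \<open>An arc is the two-element set of its endpoints; the arc \<open>(i, j)\<close> is \<open>{i, j}\<close> with \<open>i < j\<close>.\<close>

type_synonym web = "nat set set"

definition webs :: "nat \<Rightarrow> web set" where
  "webs n = {w. partition_on {1..2 * n} w \<and> (\<forall>a\<in>w. card a = 2) \<and>
                \<not> (\<exists>i j k l. i < j \<and> j < k \<and> k < l \<and> {i, k} \<in> w \<and> {j, l} \<in> w)}"

definition partner :: "web \<Rightarrow> nat \<Rightarrow> nat" where
  "partner w i = (THE j. {i, j} \<in> w)"

definition reconnect :: "nat \<Rightarrow> web \<Rightarrow> web" where
  "reconnect i w =
     (w - {{i, partner w i}, {i + 1, partner w (i + 1)}}) \<union>
     {{i, i + 1}, {partner w i, partner w (i + 1)}}"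

definition s_on_web :: "nat \<Rightarrow> web \<Rightarrow> (web \<Rightarrow>\<^sub>0 complex)" where
  "s_on_web i w =
     (if {i, i + 1} \<in> w then - Poly_Mapping.single w 1
      else Poly_Mapping.single w 1 + Poly_Mapping.single (reconnect i w) 1)"

definition s_act :: "nat \<Rightarrow> (web \<Rightarrow>\<^sub>0 complex) \<Rightarrow> (web \<Rightarrow>\<^sub>0 complex)" where
  "s_act i x = (\<Sum>w\<in>Poly_Mapping.keys x. fscale (Poly_Mapping.lookup x w) (s_on_web i w))"

text \<open>The action of \<open>s\<^bsub>i_k\<^esub> \<dots> s\<^bsub>i_1\<^esub>\<close> is given by the word \<open>[i_1, \<dots>, i_k]\<close>: its first letter
  acts first.\<close>

definition word_act :: "nat list \<Rightarrow> (web \<Rightarrow>\<^sub>0 complex) \<Rightarrow> (web \<Rightarrow>\<^sub>0 complex)" where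
  "word_act ks x = fold s_act ks x"


section \<open>The tableau graph and the web graph\<close>

definition tableau_edge :: "nat \<Rightarrow> tableau \<Rightarrow> nat \<Rightarrow> tableau \<Rightarrow> bool" where
  "tableau_edge n T i T' \<longleftrightarrow> T \<in> SYT n \<and> T' \<in> SYT n \<and>
     transpose i (i + 1) \<circ> T = T' \<and> i \<in> row n T 2 \<and> i + 1 \<in> row n T 1"

text \<open>\<open>tableau_path n T ks T'\<close>: \<open>ks\<close> lists, in order, the labels of a directed path from \<open>T\<close> to \<open>T'\<close>.\<close>

inductive tableau_path :: "nat \<Rightarrow> tableau \<Rightarrow> nat list \<Rightarrow> tableau \<Rightarrow> bool" for n where
  Nil: "T \<in> SYT n \<Longrightarrow> tableau_path n T [] T"
| Cons: "tableau_edge n T i T' \<Longrightarrow> tableau_path n T' ks T'' \<Longrightarrow> tableau_path n T (i # ks) T''"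

definition web_edge :: "nat \<Rightarrow> web \<Rightarrow> nat \<Rightarrow> web \<Rightarrow> bool" where
  "web_edge n w i w' \<longleftrightarrow> w \<in> webs n \<and> w' \<in> webs n \<and>
     s_act i (Poly_Mapping.single w 1) = Poly_Mapping.single w 1 + Poly_Mapping.single w' 1 \<and>
     (\<exists>j k. j < i \<and> i + 1 < k \<and> {j, i} \<in> w \<and> {i + 1, k} \<in> w)"

definition web_le :: "nat \<Rightarrow> web \<Rightarrow> web \<Rightarrow> bool" where
  "web_le n = (\<lambda>w w'. \<exists>i. web_edge n w i w')\<^sup>*\<^sup>*"


section \<open>The maps \<open>\<psi>\<close> and \<open>\<phi>\<close>\<close>

definition psi_step :: "nat \<Rightarrow> web \<Rightarrow> web" where
  "psi_step b w = insert {Max {a \<in> {1..<b}. a \<notin> \<Union> w}, b} w"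

definition psi :: "nat \<Rightarrow> tableau \<Rightarrow> web" where
  "psi n T = fold psi_step (map (\<lambda>c. T (2, c)) [1..<n + 1]) {}"

definition T0 :: "nat \<Rightarrow> tableau" where
  "T0 n = (\<lambda>(r, c). if (r, c) \<in> cells n then (if r = 1 then 2 * c - 1 else 2 * c) else 0)"

definition w0 :: "nat \<Rightarrow> web" where
  "w0 n = (\<lambda>c. {2 * c - 1, 2 * c}) ` {1..n}"

text \<open>The value \<open>\<sigma> \<cdot> w\<^sub>0\<close> does not depend on the path, so any path may be chosen.\<close>

definition phi_value :: "nat \<Rightarrow> tableau \<Rightarrow> (web \<Rightarrow>\<^sub>0 complex)" where
  "phi_value n T =
     word_act (SOME ks. tableau_path n (T0 n) ks T) (Poly_Mapping.single (w0 n) 1)"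

text \<open>The linear map on the Specht module that sends the basis vector \<open>v\<^sub>T\<close>, \<open>T \<in> SYT n\<close>,
  to \<open>phi_value n T\<close>: \<open>free.representation\<close> gives the coordinates with respect to that basis.\<close>

definition phi :: "nat \<Rightarrow> (tableau set \<Rightarrow>\<^sub>0 complex) \<Rightarrow> (web \<Rightarrow>\<^sub>0 complex)" where
  "phi n = (\<lambda>x\<in>specht n. \<Sum>T\<in>SYT n.
     fscale (free.representation (polytabloid n ` SYT n) x (polytabloid n T)) (phi_value n T))"

end

theory Submission
  imports Defs
begin

text \<open>
  The partial order of the web graph is a dominance order. Read a web as a word of openers (left
  endpoints of arcs) and closers (right endpoints). Noncrossing matchings are determined by their
  openers (\<open>openers_inj\<close>), so a web is a Dyck path whose height after \<open>m\<close> steps is \<open>2 * c - m\<close>, where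
  \<open>c\<close> counts the openers up to \<open>m\<close>. An edge labelled \<open>i\<close> of the web graph turns a valley of the path at
  \<open>i\<close> into a peak. If one Dyck path lies weakly below another and differs from it, then at a lowest
  point where they differ the lower path has a valley, and raising this valley keeps it below. Hence
  \<open>v \<preceq> w\<close> as soon as the path of \<open>v\<close> lies below that of \<open>w\<close> (\<open>dominated_imp_web_le\<close>).

  The bijection \<open>\<psi>\<close> turns the first row of a tableau into the openers of a web (\<open>psi_web\<close>), so an edge
  labelled \<open>i\<close> of the tableau graph raises a valley at \<open>i\<close> as well. It remains to see that if all webs
  in the support of a vector lie below a path with a valley at \<open>i\<close>, then all webs in the support of
  its image under \<open>s\<^sub>i\<close> lie below the raised path (\<open>keys_s_on_web\<close>). The action of \<open>s\<^sub>i\<close> on a web \<open>v\<close>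
  produces besides \<open>v\<close> at most the web reconnected at \<open>i\<close>. If \<open>v\<close> has a valley at \<open>i\<close>, reconnecting
  raises that valley, just as the bounding path is raised. Otherwise reconnecting only moves one
  opener to the right, which lowers the path. Starting from \<open>w\<^sub>0\<close>, whose openers are the first row of
  \<open>T\<^sub>0\<close>, induction along a path in the tableau graph (\<open>keys_word_act\<close>) bounds the support of
  \<open>phi_value n T'\<close> by the first row of \<open>T'\<close>.

  Finally, \<open>phi\<close> is given through coordinates with respect to the standard polytabloids. These are
  pairwise distinct (\<open>polytabloid_inj\<close>), so \<open>phi\<close> sends the polytabloid of \<open>T'\<close> to no other value than
  \<open>phi_value n T'\<close>, and every standard tableau is reached by a path from \<open>T\<^sub>0\<close>
  (\<open>tableau_path_exists\<close>).
\<close>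

section \<open>Webs as noncrossing matchings\<close>

lemma web_arc_distinct:
  assumes "w \<in> webs n" "{x, y} \<in> w"
  shows "x \<noteq> y"
  using assms by (auto simp: webs_def)

lemma web_arc_range:
  assumes "w \<in> webs n" "{x, y} \<in> w"
  shows "x \<in> {1..2 * n}" "y \<in> {1..2 * n}"
  using assms by (auto simp: webs_def partition_on_def)

lemma web_arc_unique:
  assumes "w \<in> webs n" "{x, y} \<in> w" "{x, z} \<in> w"
  shows "y = z"
proof -
  have "disjoint w"
    using assms by (auto simp: webs_def partition_on_def)
  then have "{x, y} = {x, z}"
    using assms(2,3) disjointD[of w "{x, y}" "{x, z}"] by auto
  then show ?thesis
    by (auto simp: doubleton_eq_iff)
qed

lemma web_arc_iff:
  assumes "w \<in> webs n" "{x, y} \<in> w"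
  shows "{x, z} \<in> w \<longleftrightarrow> z = y" "{z, x} \<in> w \<longleftrightarrow> z = y"
proof -
  show "{x, z} \<in> w \<longleftrightarrow> z = y"
    using web_arc_unique[OF assms, of z] assms(2) by metis
  then show "{z, x} \<in> w \<longleftrightarrow> z = y"
    by (simp add: insert_commute)
qed

lemma web_arc_exists:
  assumes "w \<in> webs n" "x \<in> {1..2 * n}"
  obtains y where "{x, y} \<in> w"
proof -
  have "\<Union> w = {1..2 * n}"
    using assms by (auto simp: webs_def partition_on_def)
  then obtain a where a: "a \<in> w" "x \<in> a"
    using assms(2) by blast
  then have "card a = 2"
    using assms by (auto simp: webs_def)
  then obtain p q where "a = {p, q}"
    by (meson card_2_iff)
  with a that show thesis
    by (auto simp: insert_commute)
qed

lemma web_arcE: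
  assumes "w \<in> webs n" "a \<in> w"
  obtains x y where "a = {x, y}" "x < y"
proof -
  have "card a = 2"
    using assms by (auto simp: webs_def)
  then obtain p q where "a = {p, q}" "p \<noteq> q"
    by (meson card_2_iff)
  then show thesis
    using that[of p q] that[of q p] by (cases "p < q") auto
qed

lemma web_partner:
  assumes "w \<in> webs n" "{x, y} \<in> w"
  shows "partner w x = y"
  unfolding partner_def
proof (rule the_equality)
  show "z = y" if "{x, z} \<in> w" for z
    using web_arc_unique[OF assms(1) that assms(2)] .
qed (rule assms(2))

lemma web_noncrossing:
  assumes "w \<in> webs n" "{a, b} \<in> w" "{p, q} \<in> w" "a < p" "p < b" "b < q"
  shows False
  using assms unfolding webs_def by blast

lemma websI:
  assumes "\<And>a. a \<in> w \<Longrightarrow> \<exists>x y. a = {x, y} \<and> x \<noteq> y"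
    and "\<And>x y z. {x, y} \<in> w \<Longrightarrow> {x, z} \<in> w \<Longrightarrow> y = z"
    and "\<Union> w = {1..2 * n}"
    and "\<And>a b p q. \<lbrakk>{a, b} \<in> w; {p, q} \<in> w; a < p; p < b; b < q\<rbrakk> \<Longrightarrow> False"
  shows "w \<in> webs n"
proof -
  have "a = b" if ab: "a \<in> w" "b \<in> w" "x \<in> a" "x \<in> b" for a b x
  proof -
    obtain y z where "a = {x, y}" "b = {x, z}"
      using assms(1)[OF ab(1)] assms(1)[OF ab(2)] ab(3,4) by (auto simp: insert_commute)
    then show ?thesis
      using assms(2) ab by blast
  qed
  then have "disjoint w"
    unfolding disjoint_def by blast
  moreover have "{} \<notin> w"
    using assms(1) by blast
  moreover have "\<forall>a\<in>w. card a = 2"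
    using assms(1) by fastforce
  ultimately show ?thesis
    using assms(3,4) by (auto simp: webs_def partition_on_def) blast
qed

text \<open>This form of the noncrossing condition does not mention the order of the endpoints of either
  arc, which saves distinguishing cases when arcs are recombined.\<close>

lemma web_noncrossing_xor:
  assumes "w \<in> webs n" "{a, b} \<in> w" "{p, q} \<in> w" "p \<noteq> a" "p \<noteq> b"
  shows "((p < a) \<noteq> (q < a)) = ((p < b) \<noteq> (q < b))"
proof -
  have arcs: "{a, b} \<in> w" "{b, a} \<in> w" "{p, q} \<in> w" "{q, p} \<in> w"
    using assms by (auto simp: insert_commute)
  have "q \<noteq> a" "q \<noteq> b"
    using web_arc_unique[OF assms(1)] arcs assms(4,5) by blast+
  then have "a < p \<longleftrightarrow> \<not> p < a" "a < q \<longleftrightarrow> \<not> q < a" "b < p \<longleftrightarrow> \<not> p < b" "b < q \<longleftrightarrow> \<not> q < b"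
    using assms(4,5) by auto
  moreover note nc = web_noncrossing[OF assms(1)]
  have "\<not> (a < p \<and> p < b \<and> b < q)" "\<not> (a < q \<and> q < b \<and> b < p)"
    "\<not> (b < p \<and> p < a \<and> a < q)" "\<not> (b < q \<and> q < a \<and> a < p)"
    "\<not> (p < a \<and> a < q \<and> q < b)" "\<not> (p < b \<and> b < q \<and> q < a)"
    "\<not> (q < a \<and> a < p \<and> p < b)" "\<not> (q < b \<and> b < p \<and> p < a)"
    using nc[OF arcs(1,3)] nc[OF arcs(1,4)] nc[OF arcs(2,3)] nc[OF arcs(2,4)]
      nc[OF arcs(3,1)] nc[OF arcs(3,2)] nc[OF arcs(4,1)] nc[OF arcs(4,2)] by blast+
  ultimately show ?thesis
    by argo
qed

definition openers :: "web \<Rightarrow> nat set" where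
  "openers w = {x. \<exists>y>x. {x, y} \<in> w}"

lemma openers_subset:
  assumes "w \<in> webs n"
  shows "openers w \<subseteq> {1..2 * n}"
  unfolding openers_def using web_arc_range(1)[OF assms] by blast

lemma arc_opener_iff:
  assumes "w \<in> webs n" "{x, y} \<in> w"
  shows "x \<in> openers w \<longleftrightarrow> x < y"
  unfolding openers_def using web_arc_iff(1)[OF assms] by simp

text \<open>If two webs with the same openers joined the closer \<open>b\<close> to different openers \<open>x < x'\<close>, then in the
  web with arc \<open>(x, b)\<close> the opener \<open>x'\<close> lies under that arc, so its partner \<open>c\<close> is a closer before \<open>b\<close>.
  By induction the other web joins \<open>c\<close> to \<open>x'\<close> too, but there \<open>x'\<close> is already joined to \<open>b\<close>.\<close>

lemma openers_agree_imp_arc: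
  assumes v: "v \<in> webs n" and w: "w \<in> webs n" and eq: "openers v = openers w"
  shows "\<lbrakk>{a, b} \<in> v; {a', b} \<in> w; a < b; a' < b\<rbrakk> \<Longrightarrow> a = a'"
proof (induction b arbitrary: a a' rule: less_induct)
  case (less b)
  have shorter: "False"
    if v: "v \<in> webs n" and w: "w \<in> webs n" and eq: "openers v = openers w"
      and arcs: "{x, b} \<in> v" "{x', b} \<in> w" "x < x'" "x' < b"
      and IH: "\<And>c y y'. \<lbrakk>c < b; {y, c} \<in> v; {y', c} \<in> w; y < c; y' < c\<rbrakk> \<Longrightarrow> y = y'"
    for v w x x'
  proof -
    have "x' \<in> openers v"
      using arcs eq by (auto simp: openers_def)
    then obtain c where c: "{x', c} \<in> v" "x' < c"
      by (auto simp: openers_def)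
    have "c \<noteq> b"
      using web_arc_unique[OF v, of b x x'] arcs c by (auto simp: insert_commute)
    moreover have "\<not> b < c"
      using web_noncrossing[OF v arcs(1) c(1)] arcs by blast
    ultimately have "c < b"
      by simp
    have cv: "{c, x'} \<in> v"
      using c by (simp add: insert_commute)
    have "c \<in> {1..2 * n}"
      using web_arc_range[OF v cv] by simp
    then obtain y where y: "{c, y} \<in> w"
      using web_arc_exists[OF w] by blast
    have "c \<notin> openers w"
      using arc_opener_iff[OF v cv] c eq by simp
    then have "y < c"
      using arc_opener_iff[OF w y] web_arc_distinct[OF w y] by simp
    then have "x' = y"
      using IH[of c x' y] \<open>c < b\<close> c y by (simp add: insert_commute)
    then have "c = b"
      using web_arc_unique[OF w, of x' c b] y arcs by (simp add: insert_commute)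
    with \<open>c \<noteq> b\<close> show False ..
  qed
  have "\<not> a < a'"
    using shorter[OF v w eq less.prems(1,2)] less by blast
  moreover have "\<not> a' < a"
    using shorter[OF w v eq[symmetric] less.prems(2,1)] less by blast
  ultimately show ?case
    by simp
qed

lemma openers_inj:
  assumes v: "v \<in> webs n" and w: "w \<in> webs n" and eq: "openers v = openers w"
  shows "v = w"
proof -
  have sub: "v \<subseteq> w"
    if v: "v \<in> webs n" and w: "w \<in> webs n" and eq: "openers v = openers w" for v w
  proof
    fix a assume "a \<in> v"
    then obtain x y where a: "a = {x, y}" "x < y"
      using web_arcE[OF v] by blast
    then have arc: "{y, x} \<in> v"
      using \<open>a \<in> v\<close> by (simp add: insert_commute)
    obtain z where z: "{y, z} \<in> w"
      using web_arc_exists[OF w] web_arc_range[OF v arc] by blast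
    have "y \<notin> openers w"
      using arc_opener_iff[OF v arc] a eq by simp
    then have "z < y"
      using arc_opener_iff[OF w z] web_arc_distinct[OF w z] by simp
    then have "x = z"
      using openers_agree_imp_arc[OF v w eq, of x y z] a arc z by (simp add: insert_commute)
    then show "a \<in> w"
      using a z by (simp add: insert_commute)
  qed
  show ?thesis
    using sub[OF v w eq] sub[OF w v eq[symmetric]] by blast
qed

lemma card_openers:
  assumes w: "w \<in> webs n"
  shows "card (openers w) = n"
proof -
  have opener: "Min {x, y} = x" if "x < y" for x y :: nat
    using that by simp
  have "openers w = Min ` w"
  proof
    show "openers w \<subseteq> Min ` w"
      unfolding openers_def using opener by (force simp: image_iff)
    show "Min ` w \<subseteq> openers w"
      using web_arcE[OF w] opener unfolding openers_def by (smt (verit) image_subset_iff mem_Collect_eq)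
  qed
  moreover have "inj_on Min w"
  proof (rule inj_onI)
    fix a b assume ab: "a \<in> w" "b \<in> w" "Min a = Min b"
    then obtain x y x' y' where "a = {x, y}" "x < y" "b = {x', y'}" "x' < y'"
      using web_arcE[OF w] by metis
    then show "a = b"
      using ab opener web_arc_unique[OF w] by metis
  qed
  ultimately have "card (openers w) = card w"
    by (simp add: card_image)
  moreover have "2 * card w = card (\<Union> w)"
    using w by (intro card_partition) (auto simp: webs_def partition_on_def disjoint_def intro: finite_UnionD)
  ultimately show ?thesis
    using w by (auto simp: webs_def partition_on_def)
qed

section \<open>Dominance of sets of openers\<close>

definition count_upto :: "nat set \<Rightarrow> nat \<Rightarrow> nat" where
  "count_upto A m = card (A \<inter> {..m})"

lemma count_upto_Suc: "count_upto A (Suc m) = count_upto A m + (if Suc m \<in> A then 1 else 0)"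
  by (auto simp: count_upto_def atMost_Suc)

lemma count_upto_move:
  assumes "p \<in> A" "q \<notin> A"
  shows "count_upto (insert q (A - {p})) m + (if p \<le> m then 1 else 0) =
         count_upto A m + (if q \<le> m then 1 else 0)"
proof -
  have "insert q (A - {p}) \<inter> {..m} =
        (if q \<le> m then insert q (A \<inter> {..m} - {p}) else A \<inter> {..m} - {p})"
    by auto
  moreover have "card (A \<inter> {..m} - {p}) + (if p \<le> m then 1 else 0) = card (A \<inter> {..m})"
    using assms card_Suc_Diff1[of "A \<inter> {..m}" p] by auto
  ultimately show ?thesis
    using assms by (auto simp: count_upto_def)
qed

text \<open>For sets of openers of webs, this says that the Dyck path of \<open>A\<close> lies weakly below that
  of \<open>B\<close>.\<close>

definition dominated :: "nat set \<Rightarrow> nat set \<Rightarrow> bool" where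
  "dominated A B \<longleftrightarrow> (\<forall>m. count_upto A m \<le> count_upto B m)"

section \<open>Reconnecting two arcs\<close>

lemma reconnect_eq:
  assumes "w \<in> webs n" "{i, j} \<in> w" "{i + 1, k} \<in> w"
  shows "reconnect i w = (w - {{i, j}, {i + 1, k}}) \<union> {{i, i + 1}, {j, k}}"
  using web_partner[OF assms(1,2)] web_partner[OF assms(1,3)] by (simp add: reconnect_def)

lemma reconnect_distinct:
  assumes w: "w \<in> webs n" and j: "{i, j} \<in> w" and k: "{i + 1, k} \<in> w" and "j \<noteq> i + 1"
  shows "j \<noteq> i" "k \<noteq> i + 1" "k \<noteq> i" "j \<noteq> k"
proof -
  have arcs: "{j, i} \<in> w" "{k, i + 1} \<in> w"
    using j k by (simp_all add: insert_commute)
  show "j \<noteq> i" "k \<noteq> i + 1"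
    using web_arc_distinct[OF w j] web_arc_distinct[OF w k] by auto
  show "k \<noteq> i"
    using web_arc_iff(1)[OF w j, of "i + 1"] arcs \<open>j \<noteq> i + 1\<close> by auto
  show "j \<noteq> k"
    using web_arc_iff(1)[OF w arcs(1), of "i + 1"] arcs by auto
qed

lemma reconnect_arc_iff:
  assumes w: "w \<in> webs n" and j: "{i, j} \<in> w" and k: "{i + 1, k} \<in> w" and "j \<noteq> i + 1"
  shows "{x, y} \<in> reconnect i w \<longleftrightarrow>
     (if x = i then y = i + 1 else if x = i + 1 then y = i
      else if x = j then y = k else if x = k then y = j else {x, y} \<in> w)"
proof -
  have arcs: "{j, i} \<in> w" "{k, i + 1} \<in> w"
    using j k by (auto simp: insert_commute)
  note ne = reconnect_distinct[OF assms]
  note u = web_arc_iff[OF w j] web_arc_iff[OF w k] web_arc_iff[OF w arcs(1)] web_arc_iff[OF w arcs(2)]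
  show ?thesis
    unfolding reconnect_eq[OF w j k] using ne \<open>j \<noteq> i + 1\<close> u
    by (auto simp: doubleton_eq_iff)
qed

text \<open>The arc \<open>{i, i + 1}\<close> has no room for crossings, and the arc \<open>{j, k}\<close> runs along the two removed
  arcs, so an arc that crossed it would have crossed one of them.\<close>

lemma reconnect_web:
  assumes w: "w \<in> webs n" and j: "{i, j} \<in> w" and k: "{i + 1, k} \<in> w" and "j \<noteq> i + 1"
  shows "reconnect i w \<in> webs n"
proof (rule websI)
  note arc_iff = reconnect_arc_iff[OF assms]
  have arcs: "{j, i} \<in> w" "{k, i + 1} \<in> w"
    using j k by (auto simp: insert_commute)
  note ne = reconnect_distinct[OF assms]
  note u = web_arc_iff[OF w j] web_arc_iff[OF w k] web_arc_iff[OF w arcs(1)] web_arc_iff[OF w arcs(2)]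
  show "\<exists>x y. a = {x, y} \<and> x \<noteq> y" if a: "a \<in> reconnect i w" for a
  proof -
    consider "a \<in> w" | "a = {i, i + 1}" | "a = {j, k}"
      using a unfolding reconnect_eq[OF w j k] by blast
    then show ?thesis
    proof cases
      case 1
      then obtain x y where "a = {x, y}" "x < y"
        using web_arcE[OF w] by blast
      then show ?thesis
        by (intro exI[of _ x] exI[of _ y]) simp
    next
      case 2
      then show ?thesis
        by (intro exI[of _ i] exI[of _ "i + 1"]) simp
    next
      case 3
      then show ?thesis
        using ne by blast
    qed
  qed
  show "y = z" if "{x, y} \<in> reconnect i w" "{x, z} \<in> reconnect i w" for x y z
    using that unfolding arc_iff by (auto split: if_splits intro: web_arc_unique[OF w])
  show "\<Union> (reconnect i w) = {1..2 * n}"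
  proof -
    have "\<Union> (reconnect i w) = \<Union> w"
      unfolding reconnect_eq[OF w j k] using j k by blast
    then show ?thesis
      using w by (auto simp: webs_def partition_on_def)
  qed
  have short: False if "a < p" "p < b" "b < q" "{a, b} = {i, i + 1} \<or> {p, q} = {i, i + 1}" for a b p q
    using that by (auto simp: doubleton_eq_iff)
  \<comment> \<open>Away from \<open>i\<close> and \<open>i + 1\<close>, a point lies between \<open>j\<close> and \<open>k\<close> iff it lies under exactly one of the
    two removed arcs, and no other arc separates a point under either of those from one outside.\<close>
  have long: "((j < p) \<noteq> (k < p)) = ((j < q) \<noteq> (k < q))"
    if "{p, q} \<in> w" "p \<notin> {i, i + 1, j, k}" "q \<notin> {i, i + 1, j, k}" for p q
  proof -
    have "((i < p) \<noteq> (j < p)) = ((i < q) \<noteq> (j < q))"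
      using web_noncrossing_xor[OF w that(1) j] that by auto
    moreover have "((i + 1 < p) \<noteq> (k < p)) = ((i + 1 < q) \<noteq> (k < q))"
      using web_noncrossing_xor[OF w that(1) k] that by auto
    moreover have "(i < x) = (i + 1 < x)" if "x \<notin> {i, i + 1}" for x
      using that by auto
    ultimately show ?thesis
      using that by blast
  qed
  have kinds: "{x, y} = {i, i + 1} \<or> {x, y} = {j, k} \<or>
      {x, y} \<in> w \<and> x \<notin> {i, i + 1, j, k} \<and> y \<notin> {i, i + 1, j, k}"
    if "{x, y} \<in> reconnect i w" for x y
    using that u unfolding arc_iff by (auto split: if_splits simp: doubleton_eq_iff)
  show False if "{a, b} \<in> reconnect i w" "{p, q} \<in> reconnect i w" "a < p" "p < b" "b < q" for a b p q
  proof -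
    have "{a, b} \<noteq> {i, i + 1}" "{p, q} \<noteq> {i, i + 1}"
      using short[of a p b q] that(3-5) by blast+
    then have "{a, b} = {j, k} \<or> {a, b} \<in> w \<and> a \<notin> {i, i + 1, j, k} \<and> b \<notin> {i, i + 1, j, k}"
      "{p, q} = {j, k} \<or> {p, q} \<in> w \<and> p \<notin> {i, i + 1, j, k} \<and> q \<notin> {i, i + 1, j, k}"
      using kinds[OF that(1)] kinds[OF that(2)] by blast+
    then show False
    proof (elim disjE)
      assume "{a, b} \<in> w \<and> a \<notin> {i, i + 1, j, k} \<and> b \<notin> {i, i + 1, j, k}"
        "{p, q} \<in> w \<and> p \<notin> {i, i + 1, j, k} \<and> q \<notin> {i, i + 1, j, k}"
      then show False
        using web_noncrossing[OF w] that by blast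
    next
      assume 1: "{a, b} = {j, k}" and 2: "{p, q} \<in> w \<and> p \<notin> {i, i + 1, j, k} \<and> q \<notin> {i, i + 1, j, k}"
      show False
        using 1 2 long[of p q] that by (auto simp: doubleton_eq_iff)
    next
      assume 1: "{p, q} = {j, k}" and 2: "{a, b} \<in> w \<and> a \<notin> {i, i + 1, j, k} \<and> b \<notin> {i, i + 1, j, k}"
      show False
        using 1 2 long[of a b] that by (auto simp: doubleton_eq_iff)
    next
      assume "{a, b} = {j, k}" "{p, q} = {j, k}"
      then show False
        using that(3-5) by (auto simp: doubleton_eq_iff)
    qed
  qed
qed

lemma openers_reconnect_iff:
  assumes "w \<in> webs n" "{i, j} \<in> w" "{i + 1, k} \<in> w" "j \<noteq> i + 1"
  shows "x \<in> openers (reconnect i w) \<longleftrightarrow>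
     (if x = i then True else if x = i + 1 then False
      else if x = j then j < k else if x = k then k < j else x \<in> openers w)"
  unfolding openers_def mem_Collect_eq reconnect_arc_iff[OF assms] by auto

text \<open>Raising a valley: \<open>j\<close> stays an opener and \<open>k\<close> stays a closer, only \<open>i\<close> and \<open>i + 1\<close> exchange their
  types.\<close>

lemma openers_reconnect_up:
  assumes w: "w \<in> webs n" and j: "{i, j} \<in> w" and k: "{i + 1, k} \<in> w" and "j < i" "i + 1 < k"
  shows "openers (reconnect i w) = insert i (openers w - {i + 1})"
proof (rule set_eqI)
  fix x
  have ne: "j \<noteq> i + 1"
    using assms by simp
  have "{j, i} \<in> w" "{k, i + 1} \<in> w"
    using j k by (simp_all add: insert_commute)
  then have "j \<in> openers w" "k \<notin> openers w"
    using arc_opener_iff[OF w] assms(4,5) by auto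
  then show "x \<in> openers (reconnect i w) \<longleftrightarrow> x \<in> insert i (openers w - {i + 1})"
    unfolding openers_reconnect_iff[OF w j k ne] using assms(4,5) by auto
qed

text \<open>Unless \<open>i\<close> is a closer followed by an opener, \<open>reconnect i\<close> moves one opener to the right: if
  \<open>i\<close> and \<open>i + 1\<close> are both openers, \<open>i + 1\<close> becomes a closer and the nearer of the two partners an
  opener; if both are closers, the nearer partner becomes a closer and \<open>i\<close> an opener. An opener
  \<open>i\<close> followed by a closer \<open>i + 1\<close> can only be joined to it.\<close>

lemma openers_reconnect_down:
  assumes w: "w \<in> webs n" and j: "{i, j} \<in> w" and k: "{i + 1, k} \<in> w" and ne: "j \<noteq> i + 1"
    and not_up: "\<not> (j < i \<and> i + 1 < k)"
  obtains p q where "p < q" "p \<in> openers w" "q \<notin> openers w"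
    "openers (reconnect i w) = insert q (openers w - {p})"
proof -
  have arcs: "{j, i} \<in> w" "{k, i + 1} \<in> w"
    using j k by (simp_all add: insert_commute)
  note op = arc_opener_iff[OF w j] arc_opener_iff[OF w k]
    arc_opener_iff[OF w arcs(1)] arc_opener_iff[OF w arcs(2)]
  note dist = reconnect_distinct[OF w j k ne]
  note iff = openers_reconnect_iff[OF w j k ne]
  consider "i + 1 < j" "i + 1 < k" | "j < i" "k < i" | "i + 1 < j" "k < i"
    using dist ne not_up by linarith
  then show thesis
  proof cases
    case 1
    then have "k < j"
      using web_noncrossing[OF w k j] web_noncrossing[OF w j k] dist(4) by (meson less_add_one linorder_neqE_nat)
    then have "x \<in> openers (reconnect i w) \<longleftrightarrow> x \<in> insert k (openers w - {i + 1})" for x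
      unfolding iff using 1 op dist by auto
    then have "openers (reconnect i w) = insert k (openers w - {i + 1})"
      by blast
    then show thesis
      using that[of "i + 1" k] 1 op by auto
  next
    case 2
    then have "k < j"
      using web_noncrossing[OF w arcs] dist(4) by (meson less_add_one linorder_neqE_nat)
    then have "x \<in> openers (reconnect i w) \<longleftrightarrow> x \<in> insert i (openers w - {j})" for x
      unfolding iff using 2 op dist by auto
    then have "openers (reconnect i w) = insert i (openers w - {j})"
      by blast
    then show thesis
      using that[of j i] 2 op by auto
  next
    case 3
    then have False
      using web_noncrossing[OF w arcs(2) j] by simp
    then show thesis ..
  qed
qed

lemma dominated_refl: "dominated A A"
  by (simp add: dominated_def)

lemma dominated_trans: "dominated A B \<Longrightarrow> dominated B C \<Longrightarrow> dominated A C"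
  by (meson dominated_def le_trans)

lemma dominated_move_right:
  assumes "p < q" "p \<in> A" "q \<notin> A"
  shows "dominated (insert q (A - {p})) A"
  unfolding dominated_def
proof
  fix m
  show "count_upto (insert q (A - {p})) m \<le> count_upto A m"
    using count_upto_move[OF assms(2,3), of m] assms(1) by (auto split: if_splits)
qed

text \<open>Raising a valley at \<open>i\<close> changes the path at the single position \<open>i\<close>.\<close>

lemma count_upto_move_back:
  assumes "Suc i \<in> A" "i \<notin> A"
  shows "count_upto (insert i (A - {Suc i})) m = count_upto A m + (if m = i then 1 else 0)"
proof -
  consider "m < i" | "m = i" | "Suc i \<le> m"
    by linarith
  then show ?thesis
    using count_upto_move[OF assms, of m] by cases auto
qed

lemma count_upto_inj:
  assumes "\<And>m. count_upto A m = count_upto B m" "0 \<notin> A" "0 \<notin> B"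
  shows "A = B"
proof (rule set_eqI)
  fix x
  show "x \<in> A \<longleftrightarrow> x \<in> B"
    using assms count_upto_Suc[of A "x - 1"] count_upto_Suc[of B "x - 1"]
    by (cases x) (auto split: if_splits)
qed

lemma count_upto_openers:
  assumes "w \<in> webs n"
  shows "m \<ge> 2 * n \<Longrightarrow> count_upto (openers w) m = n" "count_upto (openers w) 0 = 0"
proof -
  have "openers w \<inter> {..m} = openers w" if "m \<ge> 2 * n"
    using openers_subset[OF assms] that by auto
  then show "m \<ge> 2 * n \<Longrightarrow> count_upto (openers w) m = n"
    using card_openers[OF assms] by (simp add: count_upto_def)
  have "openers w \<inter> {..0} = {}"
    using openers_subset[OF assms] by auto
  then show "count_upto (openers w) 0 = 0"
    by (simp add: count_upto_def)
qed

section \<open>The web graph is the dominance order on openers\<close>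

lemma s_act_single: "s_act i (Poly_Mapping.single w 1) = s_on_web i w"
  by (simp add: s_act_def)

lemma web_edge_reconnect:
  assumes w: "w \<in> webs n" and j: "{i, j} \<in> w" and k: "{i + 1, k} \<in> w" and "j < i" "i + 1 < k"
  shows "web_edge n w i (reconnect i w)"
proof -
  have ne: "j \<noteq> i + 1"
    using assms by simp
  have "{i, i + 1} \<notin> w"
    using web_arc_iff[OF w j] ne by auto
  then show ?thesis
    unfolding web_edge_def s_act_single s_on_web_def
    using reconnect_web[OF w j k ne] assms by (auto simp: insert_commute[of i j])
qed

text \<open>The valley to be raised is found at a position \<open>m\<close> of least height among those where the two paths
  differ. If the lower path went down from \<open>m\<close> to \<open>m + 1\<close>, or up from \<open>m - 1\<close> to \<open>m\<close>, the neighbour of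
  \<open>m\<close> would be a lower position where the paths still differ, because the upper path moves by only
  one step as well.\<close>

lemma dominated_imp_web_le:
  assumes w: "w \<in> webs n"
  shows "v \<in> webs n \<Longrightarrow> dominated (openers v) (openers w) \<Longrightarrow> web_le n v w"
proof (induction "\<Sum>m\<le>2 * n. count_upto (openers w) m - count_upto (openers v) m"
    arbitrary: v rule: less_induct)
  case less
  define cv where "cv = count_upto (openers v)"
  define cw where "cw = count_upto (openers w)"
  note v = less.prems(1)
  have le: "cv m \<le> cw m" for m
    using less.prems(2) by (simp add: dominated_def cv_def cw_def)
  have ends: "cv 0 = cw 0" "\<And>m. m \<ge> 2 * n \<Longrightarrow> cv m = cw m"
    using count_upto_openers[OF v] count_upto_openers[OF w] by (simp_all add: cv_def cw_def)
  define M where "M = {m. cv m < cw m}"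
  have M_bounds: "0 < m \<and> m < 2 * n" if "m \<in> M" for m
    using that ends by (cases "m = 0"; cases "m \<ge> 2 * n") (auto simp: M_def)
  show ?case
  proof (cases "M = {}")
    case True
    have "openers v = openers w"
    proof (rule count_upto_inj)
      show "count_upto (openers v) m = count_upto (openers w) m" for m
      proof -
        have "m \<notin> M"
          using True by simp
        then show ?thesis
          using le[of m] by (simp add: M_def cv_def cw_def)
      qed
    qed (use openers_subset[OF v] openers_subset[OF w] in auto)
    then have "v = w"
      by (rule openers_inj[OF v w])
    then show ?thesis
      by (simp add: web_le_def)
  next
    case False
    have "finite M"
      by (rule finite_subset[of _ "{..2 * n}"]) (use M_bounds in force)+
    \<comment> \<open>The height is signed: \<open>2 * cv m - m\<close> in the naturals would truncate.\<close>
    define height where "height m = 2 * int (cv m) - int m" for m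
    define m where "m = arg_min_on height M"
    have m: "m \<in> M" and min: "\<And>m'. m' \<in> M \<Longrightarrow> height m \<le> height m'"
      unfolding m_def using arg_min_if_finite[OF \<open>finite M\<close> False, of height]
      by (auto simp: not_less)
    have bounds: "0 < m" "m < 2 * n"
      using M_bounds[OF m] by auto
    then obtain l where l: "m = Suc l"
      by (cases m) auto
    have steps: "cv (Suc x) = cv x + (if Suc x \<in> openers v then 1 else 0)"
      "cw (Suc x) = cw x + (if Suc x \<in> openers w then 1 else 0)" for x
      by (simp_all add: cv_def cw_def count_upto_Suc)
    have lt: "cv m < cw m"
      using m by (simp add: M_def)
    have closer: "m \<notin> openers v"
    proof
      assume "m \<in> openers v"
      then have "cv m = cv l + 1" "cw m \<le> cw l + 1"
        using steps[of l] l by auto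
      then have "l \<in> M" "height l < height m"
        using lt l by (auto simp: M_def height_def)
      then show False
        using min[of l] by simp
    qed
    have opener: "Suc m \<in> openers v"
    proof (rule ccontr)
      assume "Suc m \<notin> openers v"
      then have "cv (Suc m) = cv m" "cw m \<le> cw (Suc m)"
        using steps[of m] by auto
      then have "Suc m \<in> M" "height (Suc m) < height m"
        using lt by (auto simp: M_def height_def)
      then show False
        using min[of "Suc m"] by simp
    qed
    obtain j where j: "{m, j} \<in> v"
      using web_arc_exists[OF v, of m] bounds by auto
    obtain k where k: "{m + 1, k} \<in> v"
      using web_arc_exists[OF v, of "m + 1"] bounds by auto
    have "j < m"
      using arc_opener_iff[OF v j] closer web_arc_distinct[OF v j] by simp
    moreover have "m + 1 < k"
      using arc_opener_iff[OF v k] opener by simp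
    ultimately have edge: "web_edge n v m (reconnect m v)"
      and openers: "openers (reconnect m v) = insert m (openers v - {Suc m})"
      using web_edge_reconnect[OF v j k] openers_reconnect_up[OF v j k] by auto
    have count: "count_upto (openers (reconnect m v)) x = cv x + (if x = m then 1 else 0)" for x
      unfolding openers using count_upto_move_back[OF opener closer] by (simp add: cv_def)
    have "dominated (openers (reconnect m v)) (openers w)"
      using le lt unfolding dominated_def count by (auto simp: cw_def Suc_leI)
    moreover have "(\<Sum>x\<le>2 * n. cw x - count_upto (openers (reconnect m v)) x) < (\<Sum>x\<le>2 * n. cw x - cv x)"
    proof (rule sum_strict_mono_ex1)
      show "\<exists>x\<in>{..2 * n}. cw x - count_upto (openers (reconnect m v)) x < cw x - cv x"
        using bounds lt by (intro bexI[of _ m]) (auto simp: count)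
    qed (auto simp: count)
    moreover have "reconnect m v \<in> webs n"
      using edge by (simp add: web_edge_def)
    ultimately have "web_le n (reconnect m v) w"
      using less.hyps[of "reconnect m v"] by (simp add: cv_def cw_def)
    then show ?thesis
      using edge unfolding web_le_def by (metis (mono_tags, lifting) converse_rtranclp_into_rtranclp)
  qed
qed


section \<open>How the action moves the support\<close>

text \<open>The set \<open>A\<close> plays the part of a bounding path with a valley at \<open>i\<close>. A valley of \<open>v\<close> at \<open>i\<close> is raised
  together with that of \<open>A\<close>; in every other case the new web lies below \<open>v\<close>.\<close>

lemma keys_s_on_web:
  assumes v: "v \<in> webs n" and dom: "dominated (openers v) A"
    and A: "i \<notin> A" "Suc i \<in> A" and i: "1 \<le> i" "Suc i \<le> 2 * n"
    and u: "u \<in> Poly_Mapping.keys (s_on_web i v)"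
  shows "u \<in> webs n \<and> dominated (openers u) (insert i (A - {Suc i}))"
proof -
  note count = count_upto_move_back[OF A(2,1)]
  have dom': "dominated A (insert i (A - {Suc i}))"
    by (simp add: dominated_def count)
  obtain j where j: "{i, j} \<in> v"
    using web_arc_exists[OF v, of i] i by auto
  obtain k where k: "{i + 1, k} \<in> v"
    using web_arc_exists[OF v, of "i + 1"] i by auto
  have "u = v \<or> (j \<noteq> i + 1 \<and> u = reconnect i v)"
  proof (cases "j = i + 1")
    case True
    then show ?thesis
      using u j by (simp add: s_on_web_def)
  next
    case False
    then have "{i, i + 1} \<notin> v"
      using web_arc_iff(1)[OF v j, of "i + 1"] by auto
    then show ?thesis
      using u False keys_add[of "Poly_Mapping.single v (1::complex)" "Poly_Mapping.single (reconnect i v) 1"]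
      by (auto simp: s_on_web_def)
  qed
  then show ?thesis
  proof (elim disjE conjE)
    assume "u = v"
    then show ?thesis
      using v dom dom' dominated_trans by blast
  next
    assume ne: "j \<noteq> i + 1" and u: "u = reconnect i v"
    have "dominated (openers (reconnect i v)) (insert i (A - {Suc i}))"
    proof (cases "j < i \<and> i + 1 < k")
      case True
      then have "i \<notin> openers v" "Suc i \<in> openers v"
        using arc_opener_iff[OF v j] arc_opener_iff[OF v k] by auto
      then have "count_upto (openers (reconnect i v)) m =
          count_upto (openers v) m + (if m = i then 1 else 0)" for m
        using openers_reconnect_up[OF v j k] True count_upto_move_back by simp
      then show ?thesis
        using dom by (simp add: dominated_def count)
    next
      case False
      then obtain p q where "p < q" "p \<in> openers v" "q \<notin> openers v"
        "openers (reconnect i v) = insert q (openers v - {p})"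
        using openers_reconnect_down[OF v j k ne] by blast
      then have "dominated (openers (reconnect i v)) (openers v)"
        using dominated_move_right by simp
      then show ?thesis
        using dom dom' dominated_trans by blast
    qed
    then show ?thesis
      using reconnect_web[OF v j k ne] u by simp
  qed
qed

lemma keys_s_act:
  assumes "u \<in> Poly_Mapping.keys (s_act i x)"
  obtains v where "v \<in> Poly_Mapping.keys x" "u \<in> Poly_Mapping.keys (s_on_web i v)"
proof -
  have "(\<Sum>v\<in>Poly_Mapping.keys x.
      Poly_Mapping.lookup (fscale (Poly_Mapping.lookup x v) (s_on_web i v)) u) \<noteq> 0"
    using assms by (simp add: s_act_def lookup_sum in_keys_iff)
  then obtain v where "v \<in> Poly_Mapping.keys x"
    "Poly_Mapping.lookup (fscale (Poly_Mapping.lookup x v) (s_on_web i v)) u \<noteq> 0"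
    by (rule sum.not_neutral_contains_not_neutral)
  then show thesis
    using that by (simp add: in_keys_iff)
qed

section \<open>Standard tableaux\<close>

lemma tableaux_eq_iff:
  assumes "T \<in> tableaux n" "(r, c) \<in> cells n" "(r', c') \<in> cells n"
  shows "T (r, c) = T (r', c') \<longleftrightarrow> r = r' \<and> c = c'"
  using assms by (auto simp: tableaux_def bij_betw_def dest: inj_onD)

lemma tableaux_rows:
  assumes "T \<in> tableaux n"
  shows "row n T 1 \<union> row n T 2 = {1..2 * n}" "row n T 1 \<inter> row n T 2 = {}"
proof -
  have "row n T 1 \<union> row n T 2 = T ` cells n"
    by (auto simp: row_def cells_def)
  also have "\<dots> = {1..2 * n}"
    using assms by (auto simp: tableaux_def bij_betw_def)
  finally show "row n T 1 \<union> row n T 2 = {1..2 * n}" .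
  show "row n T 1 \<inter> row n T 2 = {}"
    using tableaux_eq_iff[OF assms] by (auto simp: row_def cells_def)
qed

lemma SYT_tableaux: "T \<in> SYT n \<Longrightarrow> T \<in> tableaux n"
  by (simp add: SYT_def)

lemma SYT_row_less_iff:
  assumes "T \<in> SYT n" "r \<in> {1, 2}" "c \<in> {1..n}" "d \<in> {1..n}"
  shows "T (r, c) < T (r, d) \<longleftrightarrow> c < d"
  using assms strict_mono_on_less[of "{1..n}" "\<lambda>c. T (r, c)" c d] by (auto simp: SYT_def)

lemma SYT_column_less:
  assumes "T \<in> SYT n" "c \<in> {1..n}"
  shows "T (1, c) < T (2, c)"
  using assms by (simp add: SYT_def)

lemma SYT_row_eqI:
  assumes T: "T \<in> SYT n" and T': "T' \<in> SYT n" and r: "r \<in> {1, 2}"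
    and row: "row n T r = row n T' r" and c: "c \<in> {1..n}"
  shows "T (r, c) = T' (r, c)"
proof -
  have sorted: "sorted (map (\<lambda>c. T (r, c)) [1..<n + 1])" "distinct (map (\<lambda>c. T (r, c)) [1..<n + 1])"
    if "T \<in> SYT n" for T
  proof -
    have sm: "strict_mono_on {1..n} (\<lambda>c. T (r, c))"
      using that r by (auto simp: SYT_def)
    then show "distinct (map (\<lambda>c. T (r, c)) [1..<n + 1])"
      using strict_mono_on_imp_inj_on[OF sm]
      by (simp add: distinct_map atLeastLessThanSuc_atLeastAtMost del: upt_Suc)
    show "sorted (map (\<lambda>c. T (r, c)) [1..<n + 1])"
      unfolding sorted_map
      by (rule sorted_wrt_mono_rel[of _ "(\<le>)"])
        (use strict_mono_on_leD[OF sm] in \<open>auto simp: sorted_upt simp del: upt_Suc\<close>)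
  qed
  have "map (\<lambda>c. T (r, c)) [1..<n + 1] = map (\<lambda>c. T' (r, c)) [1..<n + 1]"
    using sorted[OF T] sorted[OF T'] row
    by (intro sorted_distinct_set_unique)
      (auto simp: row_def atLeastLessThanSuc_atLeastAtMost simp del: upt_Suc)
  then show ?thesis
    using c by (auto simp del: upt_Suc)
qed

lemma SYT_eqI:
  assumes T: "T \<in> SYT n" and T': "T' \<in> SYT n" and row: "row n T 1 = row n T' 1"
  shows "T = T'"
proof
  fix x :: "nat \<times> nat"
  have "row n T 2 = row n T' 2"
    using tableaux_rows[OF SYT_tableaux[OF T]] tableaux_rows[OF SYT_tableaux[OF T']] row by blast
  then have "T (r, c) = T' (r, c)" if "(r, c) \<in> cells n" for r c
    using SYT_row_eqI[OF T T' _ _ , of r c] row that by (auto simp: cells_def)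
  moreover have "T x = T' x" if "x \<notin> cells n"
  proof -
    have "\<forall>x. x \<notin> cells n \<longrightarrow> T x = 0" "\<forall>x. x \<notin> cells n \<longrightarrow> T' x = 0"
      using SYT_tableaux[OF T] SYT_tableaux[OF T'] unfolding tableaux_def by blast+
    then show ?thesis
      using that by metis
  qed
  ultimately show "T x = T' x"
    by (cases x) blast
qed

lemma transpose_Suc_less:
  fixes x y :: nat
  assumes "x < y" "\<not> (x = i \<and> y = Suc i)"
  shows "transpose i (Suc i) x < transpose i (Suc i) y"
  using assms by (auto simp: transpose_def)

lemma transpose_SYT:
  assumes T: "T \<in> SYT n" and e: "e \<in> {1..n}" "T (1, e) = i" and d: "d \<in> {1..n}" "T (2, d) = Suc i"
    and "d \<noteq> e"
  shows "transpose i (Suc i) \<circ> T \<in> SYT n"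
proof -
  let ?S = "transpose i (Suc i) \<circ> T"
  note eq = tableaux_eq_iff[OF SYT_tableaux[OF T]]
  have bij: "bij_betw T (cells n) {1..2 * n}" and off: "\<And>x. x \<notin> cells n \<Longrightarrow> T x = 0"
    using T by (auto simp: SYT_def tableaux_def)
  have "i \<in> {1..2 * n}" "Suc i \<in> {1..2 * n}"
    using bij_betwE[OF bij] e d by (force simp: cells_def)+
  then have "transpose i (Suc i) permutes {1..2 * n}" "i \<noteq> 0"
    by (auto intro: permutes_swap_id)
  then have tab: "?S \<in> tableaux n"
    unfolding tableaux_def using bij_betw_trans[OF bij permutes_imp_bij] off
    by (auto simp: transpose_def)
  have rows: "strict_mono_on {1..n} (\<lambda>c. ?S (r, c))" if r: "r \<in> {1, 2}" for r
  proof (rule strict_mono_onI)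
    fix x y assume xy: "x \<in> {1..n}" "y \<in> {1..n}" "x < y"
    have "\<not> (T (r, x) = i \<and> T (r, y) = Suc i)"
      using eq[of r x 1 e] eq[of r y 2 d] r xy e d by (auto simp: cells_def)
    then show "?S (r, x) < ?S (r, y)"
      using transpose_Suc_less[of "T (r, x)" "T (r, y)" i] SYT_row_less_iff[OF T r xy(1,2)] xy by simp
  qed
  have "?S (1, c) < ?S (2, c)" if c: "c \<in> {1..n}" for c
  proof -
    have "\<not> (T (1, c) = i \<and> T (2, c) = Suc i)"
      using eq[of 1 c 1 e] eq[of 2 c 2 d] \<open>d \<noteq> e\<close> c e d by (auto simp: cells_def)
    then show ?thesis
      using transpose_Suc_less[of "T (1, c)" "T (2, c)" i] SYT_column_less[OF T c] by simp
  qed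
  then show ?thesis
    using tab rows by (simp add: SYT_def)
qed

lemma tableau_edge_row:
  assumes "tableau_edge n T i T'"
  shows "i \<notin> row n T 1" "Suc i \<in> row n T 1" "1 \<le> i" "Suc i \<le> 2 * n"
    "row n T' 1 = insert i (row n T 1 - {Suc i})"
proof -
  have T: "T \<in> tableaux n" and T': "T' = transpose i (Suc i) \<circ> T"
    and i: "i \<in> row n T 2" "Suc i \<in> row n T 1"
    using assms by (auto simp: tableau_edge_def SYT_tableaux)
  show ni: "i \<notin> row n T 1" and "Suc i \<in> row n T 1" and "1 \<le> i" "Suc i \<le> 2 * n"
    using i tableaux_rows[OF T] by auto
  have "row n T' 1 = transpose i (Suc i) ` row n T 1"
    by (simp add: T' row_def image_image)
  also have "\<dots> = insert i (row n T 1 - {Suc i})"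
    using ni i(2) by (auto simp: transpose_def image_iff split: if_splits)
  finally show "row n T' 1 = insert i (row n T 1 - {Suc i})" .
qed

lemma keys_word_act:
  assumes "tableau_path n T ks T'"
    and "\<forall>u\<in>Poly_Mapping.keys x. u \<in> webs n \<and> dominated (openers u) (row n T 1)"
  shows "\<forall>u\<in>Poly_Mapping.keys (word_act ks x). u \<in> webs n \<and> dominated (openers u) (row n T' 1)"
  using assms
proof (induction arbitrary: x rule: tableau_path.induct)
  case (Nil T)
  then show ?case
    by (simp add: word_act_def)
next
  case (Cons T i T' ks T'')
  note edge = tableau_edge_row[OF Cons.hyps(1)]
  have "u \<in> webs n \<and> dominated (openers u) (row n T' 1)" if u: "u \<in> Poly_Mapping.keys (s_act i x)" for u
  proof -
    obtain v where v: "v \<in> Poly_Mapping.keys x" "u \<in> Poly_Mapping.keys (s_on_web i v)"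
      using keys_s_act[OF u] by blast
    then show ?thesis
      unfolding edge(5) using keys_s_on_web[OF _ _ edge(1-4) v(2)] Cons.prems by blast
  qed
  then have "\<forall>u\<in>Poly_Mapping.keys (word_act ks (s_act i x)).
      u \<in> webs n \<and> dominated (openers u) (row n T'' 1)"
    by (intro Cons.IH) blast
  then show ?case
    by (simp add: word_act_def)
qed


section \<open>The initial tableau and paths from it\<close>

lemma T0_SYT: "T0 n \<in> SYT n"
proof -
  have "inj_on (T0 n) (cells n)"
    by (rule inj_onI) (auto simp: T0_def cells_def split: if_splits; presburger)
  moreover have "T0 n ` cells n = {1..2 * n}"
  proof
    show "T0 n ` cells n \<subseteq> {1..2 * n}"
      by (auto simp: T0_def cells_def)
    show "{1..2 * n} \<subseteq> T0 n ` cells n"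
    proof
      fix x assume x: "x \<in> {1..2 * n}"
      show "x \<in> T0 n ` cells n"
      proof (cases "even x")
        case True
        then have "x = T0 n (2, x div 2)" "(2, x div 2) \<in> cells n"
          using x by (auto simp: T0_def cells_def)
        then show ?thesis
          by blast
      next
        case False
        then have "x = T0 n (1, (x + 1) div 2)" "(1, (x + 1) div 2) \<in> cells n"
          using x by (auto simp: T0_def cells_def elim!: oddE)
        then show ?thesis
          by blast
      qed
    qed
  qed
  ultimately have "bij_betw (T0 n) (cells n) {1..2 * n}"
    by (simp add: bij_betw_def)
  then have "T0 n \<in> tableaux n"
    by (auto simp: tableaux_def T0_def)
  moreover have "strict_mono_on {1..n} (\<lambda>c. T0 n (r, c))" if "r \<in> {1, 2}" for r
    using that by (intro strict_mono_onI) (auto simp: T0_def cells_def)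
  moreover have "T0 n (1, c) < T0 n (2, c)" if "c \<in> {1..n}" for c
    using that by (auto simp: T0_def cells_def)
  ultimately show ?thesis
    by (simp add: SYT_def)
qed

lemma w0_arc_iff:
  "{x, y} \<in> w0 n \<longleftrightarrow> (\<exists>c\<in>{1..n}. x = 2 * c - 1 \<and> y = 2 * c \<or> x = 2 * c \<and> y = 2 * c - 1)"
  by (simp add: w0_def image_iff doubleton_eq_iff)

lemma w0_web: "w0 n \<in> webs n"
proof (rule websI)
  have partner: "y = (if even x then x - 1 else x + 1)" if xy: "{x, y} \<in> w0 n" for x y
  proof -
    obtain c where "c \<in> {1..n}" "x = 2 * c - 1 \<and> y = 2 * c \<or> x = 2 * c \<and> y = 2 * c - 1"
      using xy unfolding w0_arc_iff by blast
    then show ?thesis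
      by (elim disjE) auto
  qed
  show "\<exists>x y. a = {x, y} \<and> x \<noteq> y" if "a \<in> w0 n" for a
  proof -
    obtain c where "c \<in> {1..n}" "a = {2 * c - 1, 2 * c}"
      using \<open>a \<in> w0 n\<close> by (auto simp: w0_def)
    then show ?thesis
      by (intro exI[of _ "2 * c - 1"] exI[of _ "2 * c"]) auto
  qed
  show "y = z" if "{x, y} \<in> w0 n" "{x, z} \<in> w0 n" for x y z
    using partner[OF that(1)] partner[OF that(2)] by simp
  show "\<Union> (w0 n) = {1..2 * n}"
  proof
    show "\<Union> (w0 n) \<subseteq> {1..2 * n}"
      by (auto simp: w0_def)
    show "{1..2 * n} \<subseteq> \<Union> (w0 n)"
    proof
      fix x assume "x \<in> {1..2 * n}"
      then have "(x + 1) div 2 \<in> {1..n}"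
        by auto
      moreover have "x = 2 * ((x + 1) div 2) - 1 \<or> x = 2 * ((x + 1) div 2)"
        by presburger
      then have "x \<in> {2 * ((x + 1) div 2) - 1, 2 * ((x + 1) div 2)}"
        by blast
      ultimately show "x \<in> \<Union> (w0 n)"
        unfolding w0_def by blast
    qed
  qed
  show False if "{a, b} \<in> w0 n" "{p, q} \<in> w0 n" "a < p" "p < b" "b < q" for a b p q
    using partner[OF that(1)] that(3-5) by (simp split: if_splits)
qed

lemma openers_w0: "openers (w0 n) = row n (T0 n) 1"
proof -
  have "(\<exists>y>x. {x, y} \<in> w0 n) \<longleftrightarrow> (\<exists>c\<in>{1..n}. x = 2 * c - 1)" for x
    unfolding w0_arc_iff by force
  moreover have "row n (T0 n) 1 = (\<lambda>c. 2 * c - 1) ` {1..n}"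
    by (auto simp: row_def T0_def cells_def image_iff)
  ultimately show ?thesis
    unfolding openers_def by (simp add: image_def)
qed

lemma tableau_path_snoc:
  "tableau_path n T ks T' \<Longrightarrow> tableau_edge n T' i T'' \<Longrightarrow> tableau_path n T (ks @ [i]) T''"
proof (induction rule: tableau_path.induct)
  case (Nil T)
  then have "T'' \<in> SYT n"
    by (simp add: tableau_edge_def)
  from tableau_path.Cons[OF Nil.prems tableau_path.Nil[OF this]] show ?case
    by simp
next
  case (Cons T i S ks S')
  from tableau_path.Cons[OF Cons.hyps(1) Cons.IH[OF Cons.prems]] show ?case
    by simp
qed

text \<open>Under the hypothesis the entries increase in the order \<open>(1,1), (2,1), (1,2), (2,2), \<dots>\<close>, so they are
  \<open>1, 2, 3, \<dots>\<close> in this order. The two inductions bound the entries from below starting at the first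
  column and from above starting at the last one.\<close>

lemma SYT_eq_T0:
  assumes T: "T \<in> SYT n" and alt: "\<And>c. \<lbrakk>1 \<le> c; c < n\<rbrakk> \<Longrightarrow> T (2, c) < T (1, c + 1)"
  shows "T = T0 n"
proof -
  have bij: "bij_betw T (cells n) {1..2 * n}" and off: "\<And>x. x \<notin> cells n \<Longrightarrow> T x = 0"
    using SYT_tableaux[OF T] by (auto simp: tableaux_def)
  have range: "T (r, c) \<in> {1..2 * n}" if "r \<in> {1, 2}" "c \<in> {1..n}" for r c
    using bij_betwE[OF bij] that by (auto simp: cells_def)
  have lower: "c \<in> {1..n} \<Longrightarrow> 2 * c - 1 \<le> T (1, c) \<and> 2 * c \<le> T (2, c)" for c
  proof (induction c)
    case (Suc c)
    have "2 * c < T (1, Suc c)"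
    proof (cases "c = 0")
      case True
      then show ?thesis
        using range[of 1 1] Suc.prems by auto
    next
      case False
      then show ?thesis
        using Suc alt[of c] by auto
    qed
    then show ?case
      using SYT_column_less[OF T Suc.prems] by auto
  qed simp
  have upper: "c + k = n \<Longrightarrow> 1 \<le> c \<Longrightarrow> T (2, c) \<le> 2 * c" for c k
  proof (induction k arbitrary: c)
    case 0
    then show ?case
      using range[of 2 n] by auto
  next
    case (Suc k)
    then have "T (2, Suc c) \<le> 2 * Suc c"
      using Suc.IH[of "Suc c"] by simp
    moreover have "T (1, Suc c) < T (2, Suc c)"
      using SYT_column_less[OF T, of "Suc c"] Suc.prems by simp
    moreover have "T (2, c) < T (1, Suc c)"
      using alt[of c] Suc.prems by simp
    ultimately show ?case
      by simp
  qed
  have cols: "T (1, c) = 2 * c - 1" "T (2, c) = 2 * c" if c: "c \<in> {1..n}" for c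
    using lower[OF c] upper[of c "n - c"] SYT_column_less[OF T c] c by auto
  show ?thesis
  proof
    fix x :: "nat \<times> nat"
    obtain r c where x: "x = (r, c)"
      by (cases x)
    show "T x = T0 n x"
    proof (cases "x \<in> cells n")
      case True
      then show ?thesis
        using cols[of c] by (auto simp: x T0_def cells_def)
    next
      case False
      then show ?thesis
        using off[of x] by (simp add: x T0_def)
    qed
  qed
qed

text \<open>The last edge of a path into \<open>T \<noteq> T\<^sub>0\<close> comes from the first column \<open>c\<close> with
  \<open>T (1, c + 1) < T (2, c)\<close>. The predecessor \<open>i\<close> of \<open>T (2, c)\<close> cannot be in the second row, for it
  would be in a column \<open>d < c\<close> that already has this property. So \<open>i\<close> is in the first row, beyond
  column \<open>c\<close>, and exchanging \<open>i\<close> with \<open>i + 1\<close> gives a standard tableau with a smaller second row.\<close>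

lemma tableau_path_exists: "T \<in> SYT n \<Longrightarrow> \<exists>ks. tableau_path n (T0 n) ks T"
proof (induction "\<Sum>c\<in>{1..n}. T (2, c)" arbitrary: T rule: less_induct)
  case less
  note T = less.prems
  show ?case
  proof (cases "\<forall>c. 1 \<le> c \<and> c < n \<longrightarrow> T (2, c) < T (1, c + 1)")
    case True
    then have "T = T0 n"
      using SYT_eq_T0[OF T] by blast
    then show ?thesis
      using tableau_path.Nil[OF T0_SYT] by blast
  next
    case False
    note eq = tableaux_eq_iff[OF SYT_tableaux[OF T]]
    define bad where "bad c \<longleftrightarrow> 1 \<le> c \<and> c < n \<and> \<not> T (2, c) < T (1, c + 1)" for c
    define c where "c = (LEAST c. bad c)"
    have "bad c"
      unfolding c_def by (rule LeastI_ex) (use False in \<open>auto simp: bad_def\<close>)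
    then have c: "1 \<le> c" "c < n" "T (1, c + 1) \<le> T (2, c)"
      by (auto simp: bad_def)
    have minimal: "T (2, d) < T (1, d + 1)" if "1 \<le> d" "d < c" for d
    proof -
      have "\<not> bad d"
        using not_less_Least[of d bad] that(2) unfolding c_def by blast
      then show ?thesis
        using that c(2) by (simp add: bad_def)
    qed
    define i where "i = T (2, c) - 1"
    have "T (1, c + 1) \<noteq> T (2, c)"
      using eq[of 1 "c + 1" 2 c] c by (auto simp: cells_def)
    then have lt: "T (1, c + 1) < T (2, c)"
      using c by simp
    then have i: "T (2, c) = Suc i" "T (1, c + 1) \<le> i"
      by (auto simp: i_def)
    have c_in: "c \<in> {1..n}" "c + 1 \<in> {1..n}"
      using c by auto
    have "T (1, c + 1) \<in> row n T 1" "T (2, c) \<in> row n T 2"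
      using c_in by (auto simp: row_def)
    then have "T (1, c + 1) \<in> {1..2 * n}" "T (2, c) \<in> {1..2 * n}"
      using tableaux_rows(1)[OF SYT_tableaux[OF T]] by blast+
    then have "i \<in> {1..2 * n}"
      using i by auto
    have not_row2: "T (2, d) \<noteq> i" if d: "d \<in> {1..n}" for d
    proof
      assume di: "T (2, d) = i"
      then have "d < c"
        using SYT_row_less_iff[OF T _ d c_in(1), of 2] i by simp
      then have "i < T (1, d + 1)"
        using minimal[of d] d di by simp
      moreover have "T (1, d + 1) < T (1, c + 1)"
        using SYT_row_less_iff[OF T _ _ c_in(2), of 1 "d + 1"] \<open>d < c\<close> c by simp
      ultimately show False
        using i by simp
    qed
    then have "i \<notin> row n T 2"
      unfolding row_def by blast
    then have "i \<in> row n T 1"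
      using tableaux_rows(1)[OF SYT_tableaux[OF T]] \<open>i \<in> {1..2 * n}\<close> by blast
    then obtain e where e: "e \<in> {1..n}" "T (1, e) = i"
      by (auto simp: row_def)
    have "\<not> e < c + 1"
      using SYT_row_less_iff[OF T _ e(1) c_in(2), of 1] e i by simp
    then have "c \<noteq> e"
      by simp
    define S where "S = transpose i (Suc i) \<circ> T"
    have S: "S \<in> SYT n"
      unfolding S_def by (rule transpose_SYT[OF T e c_in(1) i(1) \<open>c \<noteq> e\<close>])
    have S_vals: "S (2, c) = i" "S (1, e) = Suc i"
      using i e by (simp_all add: S_def)
    have edge: "tableau_edge n S i T"
      unfolding tableau_edge_def
    proof (intro conjI)
      show "transpose i (i + 1) \<circ> S = T"
        by (simp add: S_def fun_eq_iff)
      show "i \<in> row n S 2" "i + 1 \<in> row n S 1"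
        using S_vals c_in(1) e(1) by (force simp: row_def)+
    qed (rule S T)+
    have "(\<Sum>c\<in>{1..n}. S (2, c)) < (\<Sum>c\<in>{1..n}. T (2, c))"
    proof (rule sum_strict_mono_ex1)
      show "\<forall>d\<in>{1..n}. S (2, d) \<le> T (2, d)"
        using not_row2 by (auto simp: S_def transpose_def)
      show "\<exists>d\<in>{1..n}. S (2, d) < T (2, d)"
        using S_vals i c_in by (intro bexI[of _ c]) auto
    qed simp
    then obtain ks where "tableau_path n (T0 n) ks S"
      using less.hyps S by blast
    then show ?thesis
      using tableau_path_snoc edge by blast
  qed
qed

section \<open>The web of a standard tableau\<close>

text \<open>The invariant of the construction of \<open>\<psi>\<close>: \<open>A\<close> is the whole first row and \<open>B\<close> the part of the second
  row that has been processed. The saturation clause (no unmatched vertex lies under an arc) is what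
  keeps the next arc from crossing an earlier one.\<close>

definition prefix_matching :: "nat set \<Rightarrow> nat set \<Rightarrow> web \<Rightarrow> bool" where
  "prefix_matching A B w \<longleftrightarrow>
     (\<forall>a\<in>w. \<exists>x\<in>A. \<exists>y\<in>B. x < y \<and> a = {x, y}) \<and>
     (\<forall>x y z. {x, y} \<in> w \<longrightarrow> {x, z} \<in> w \<longrightarrow> y = z) \<and>
     (\<forall>a b p q. {a, b} \<in> w \<longrightarrow> {p, q} \<in> w \<longrightarrow> \<not> (a < p \<and> p < b \<and> b < q)) \<and>
     (\<forall>x y z. {x, y} \<in> w \<longrightarrow> x < z \<longrightarrow> z < y \<longrightarrow> z \<in> \<Union> w) \<and>
     B \<subseteq> \<Union> w \<and> card (\<Union> w \<inter> A) = card B"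

text \<open>The cardinality hypothesis provides an unmatched element of \<open>A\<close> before \<open>b\<close>. The nearest unmatched
  vertex to the left of \<open>b\<close> is therefore well defined, and it is in \<open>A\<close> because all of \<open>B\<close> is matched.\<close>

lemma prefix_matching_step:
  assumes w: "prefix_matching A B w" and fin: "finite A" "finite B"
    and disj: "A \<inter> B = {}" "b \<notin> A" and less: "\<And>y. y \<in> B \<Longrightarrow> y < b"
    and cover: "{1..<b} \<subseteq> A \<union> B" and pos: "0 \<notin> A"
    and many: "card B < card (A \<inter> {..<b})"
  shows "prefix_matching A (insert b B) (psi_step b w)"
proof -
  have arcs: "\<exists>x\<in>A. \<exists>y\<in>B. x < y \<and> a = {x, y}" if "a \<in> w" for a
    using w that unfolding prefix_matching_def by blast
  have unique: "y = z" if "{x, y} \<in> w" "{x, z} \<in> w" for x y z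
    using w that unfolding prefix_matching_def by blast
  have nc: False if "{a, b} \<in> w" "{p, q} \<in> w" "a < p" "p < b" "b < q" for a b p q
    using w that unfolding prefix_matching_def by blast
  have full: "z \<in> \<Union> w" if "{x, y} \<in> w" "x < z" "z < y" for x y z
    using w that unfolding prefix_matching_def by blast
  have B: "B \<subseteq> \<Union> w" "card (\<Union> w \<inter> A) = card B"
    using w unfolding prefix_matching_def by blast+
  have pair: "x \<in> A \<and> y \<in> B" if "{x, y} \<in> w" "x < y" for x y
    using arcs[OF that(1)] that(2) by (auto simp: doubleton_eq_iff)
  have verts: "\<Union> w \<subseteq> A \<union> B"
    using arcs by fastforce
  have "b \<notin> B"
    using less by blast
  then have b: "b \<notin> \<Union> w"
    using verts disj by blast
  define S where "S = {a \<in> {1..<b}. a \<notin> \<Union> w}"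
  have "S \<noteq> {}"
  proof
    assume "S = {}"
    have "A \<inter> {..<b} \<subseteq> \<Union> w \<inter> A"
    proof
      fix x assume x: "x \<in> A \<inter> {..<b}"
      then have "x \<noteq> 0"
        using pos by (cases x) auto
      then have "x \<in> {1..<b}"
        using x by auto
      then show "x \<in> \<Union> w \<inter> A"
        using x \<open>S = {}\<close> unfolding S_def by blast
    qed
    then have "card (A \<inter> {..<b}) \<le> card B"
      using card_mono[of "\<Union> w \<inter> A" "A \<inter> {..<b}"] fin B by simp
    then show False
      using many by simp
  qed
  moreover have "finite S"
    by (simp add: S_def)
  define m where "m = Max S"
  ultimately have m: "m \<in> S" and max: "\<And>x. x \<in> S \<Longrightarrow> x \<le> m"
    using \<open>finite S\<close> by (auto simp: m_def)
  have m': "1 \<le> m" "m < b" "m \<notin> \<Union> w"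
    using m by (auto simp: S_def)
  have "m \<in> A"
    using m' cover B by fastforce
  have step: "psi_step b w = insert {m, b} w"
    by (simp add: psi_step_def m_def S_def)
  have new: "{x, y} \<notin> w" if "x \<in> {m, b}" for x y
    using that m' b by blast
  have arc_cases: "{x, y} \<in> w \<or> x = m \<and> y = b \<or> x = b \<and> y = m"
    if "{x, y} \<in> insert {m, b} w" for x y
    using that by (auto simp: doubleton_eq_iff)
  have under: "z \<in> \<Union> w" if "m < z" "z < b" for z
    using max[of z] that by (force simp: S_def)
  have 1: "\<exists>x\<in>A. \<exists>y\<in>insert b B. x < y \<and> a = {x, y}" if "a \<in> insert {m, b} w" for a
    using that arcs[of a] \<open>m \<in> A\<close> m' by auto
  have 2: "y = z" if "{x, y} \<in> insert {m, b} w" "{x, z} \<in> insert {m, b} w" for x y z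
    using arc_cases[OF that(1)] arc_cases[OF that(2)] new[of x y] new[of x z] unique[of x y z] m'
    by auto
  have 3: False if "{a, c} \<in> insert {m, b} w" "{p, q} \<in> insert {m, b} w" "a < p" "p < c" "c < q"
    for a c p q
  proof -
    note order = that(3-5)
    note ac = arc_cases[OF that(1)] arc_cases[OF that(2)]
    consider "{a, c} \<in> w" "{p, q} \<in> w" | "{a, c} \<in> w" "p = m" | "{p, q} \<in> w" "c = b"
      using ac order m' by auto
    then show False
    proof cases
      case 1
      then show ?thesis
        using nc order by blast
    next
      case 2
      then show ?thesis
        using full[of a c m] order m' by blast
    next
      case 3
      then show ?thesis
        using pair[of p q] less[of q] order by auto
    qed
  qed
  have 4: "z \<in> \<Union> (insert {m, b} w)" if "{x, y} \<in> insert {m, b} w" "x < z" "z < y" for x y z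
    using arc_cases[OF that(1)] full[of x y z] under[of z] that(2,3) m' by auto
  have "\<Union> (insert {m, b} w) \<inter> A = insert m (\<Union> w \<inter> A)"
    using \<open>m \<in> A\<close> disj by auto
  then have 5: "card (\<Union> (insert {m, b} w) \<inter> A) = card (insert b B)"
    using B m' fin \<open>b \<notin> B\<close> by simp
  have 6: "insert b B \<subseteq> \<Union> (insert {m, b} w)"
    using B by auto
  show ?thesis
    unfolding step prefix_matching_def
  proof (intro conjI allI ballI impI notI)
    show "\<exists>x\<in>A. \<exists>y\<in>insert b B. x < y \<and> a = {x, y}" if "a \<in> insert {m, b} w" for a
      using that by (rule 1)
    show "y = z" if "{x, y} \<in> insert {m, b} w" "{x, z} \<in> insert {m, b} w" for x y z
      using that by (rule 2)
    show False if "{a, c} \<in> insert {m, b} w" "{p, q} \<in> insert {m, b} w" "a < p \<and> p < c \<and> c < q"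
      for a c p q
      using 3[OF that(1,2)] that(3) by blast
    show "z \<in> \<Union> (insert {m, b} w)" if "{x, y} \<in> insert {m, b} w" "x < z" "z < y" for x y z
      using that by (rule 4)
  qed (rule 5 6)+
qed

lemma prefix_matching_complete:
  assumes w: "prefix_matching A B w" and AB: "A \<union> B = {1..2 * n}" "A \<inter> B = {}" "card A = card B"
  shows "w \<in> webs n" "openers w = A"
proof -
  have fin: "finite A" "finite B"
    using AB(1) finite_Un[of A B] by auto
  have arcs: "\<exists>x\<in>A. \<exists>y\<in>B. x < y \<and> a = {x, y}" if "a \<in> w" for a
    using w that unfolding prefix_matching_def by blast
  have B: "B \<subseteq> \<Union> w" "card (\<Union> w \<inter> A) = card B"
    using w unfolding prefix_matching_def by blast+
  have "\<Union> w \<inter> A = A"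
    using card_subset_eq[OF fin(1), of "\<Union> w \<inter> A"] B AB by simp
  moreover have "\<Union> w \<subseteq> A \<union> B"
    using arcs by fastforce
  ultimately have U: "\<Union> w = {1..2 * n}"
    using B AB by blast
  show "w \<in> webs n"
  proof (rule websI)
    show "\<exists>x y. a = {x, y} \<and> x \<noteq> y" if "a \<in> w" for a
      using arcs[OF that] by blast
    show "y = z" if "{x, y} \<in> w" "{x, z} \<in> w" for x y z
      using w that unfolding prefix_matching_def by blast
    show False if "{a, b} \<in> w" "{p, q} \<in> w" "a < p" "p < b" "b < q" for a b p q
      using w that unfolding prefix_matching_def by blast
  qed (rule U)
  show "openers w = A"
  proof
    show "openers w \<subseteq> A"
    proof
      fix x assume "x \<in> openers w"
      then obtain y where "{x, y} \<in> w" "x < y"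
        by (auto simp: openers_def)
      then show "x \<in> A"
        using arcs[of "{x, y}"] by (auto simp: doubleton_eq_iff)
    qed
    show "A \<subseteq> openers w"
    proof
      fix x assume x: "x \<in> A"
      then obtain a where a: "a \<in> w" "x \<in> a"
        using AB U by blast
      then obtain p q where "p \<in> A" "q \<in> B" "p < q" "a = {p, q}"
        using arcs by blast
      moreover from this have "x = p"
        using a x AB by auto
      ultimately show "x \<in> openers w"
        using a by (auto simp: openers_def)
    qed
  qed
qed

text \<open>Standardness enters through the count: the first \<open>k + 1\<close> entries of the first row are smaller than
  the entry \<open>k + 1\<close> of the second row, while only \<open>k\<close> entries are matched so far.\<close>

lemma psi_prefix_matching:
  assumes T: "T \<in> SYT n"
  shows "k \<le> n \<Longrightarrow> prefix_matching (row n T 1) ((\<lambda>c. T (2, c)) ` {1..k})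
    (fold psi_step (map (\<lambda>c. T (2, c)) [1..<k + 1]) {})"
proof (induction k)
  case 0
  then show ?case
    by (simp add: prefix_matching_def)
next
  case (Suc k)
  let ?b = "T (2, Suc k)"
  let ?B = "(\<lambda>c. T (2, c)) ` {1..k}"
  let ?w = "fold psi_step (map (\<lambda>c. T (2, c)) [1..<k + 1]) {}"
  note rows = tableaux_rows[OF SYT_tableaux[OF T]]
  have k: "Suc k \<in> {1..n}"
    using Suc.prems by simp
  have inj: "inj_on (\<lambda>c. T (r, c)) {1..n}" if "r \<in> {1, 2}" for r
    using tableaux_eq_iff[OF SYT_tableaux[OF T]] that by (intro inj_onI) (auto simp: cells_def)
  have b: "?b \<in> row n T 2" and B: "?B \<subseteq> row n T 2"
    using k by (auto simp: row_def)
  have before: "T (2, c) < ?b \<longleftrightarrow> c < Suc k" if "c \<in> {1..n}" for c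
    using SYT_row_less_iff[OF T _ that k, of 2] by simp
  have "prefix_matching (row n T 1) (insert ?b ?B) (psi_step ?b ?w)"
  proof (rule prefix_matching_step)
    show "prefix_matching (row n T 1) ?B ?w"
      using Suc by simp
    show "finite (row n T 1)" "finite ?B"
      by (simp_all add: row_def)
    show "row n T 1 \<inter> ?B = {}" "?b \<notin> row n T 1" "0 \<notin> row n T 1"
      using rows b B by (blast, blast, force)
    show "y < ?b" if "y \<in> ?B" for y
      using that before k by auto
    show "{1..<?b} \<subseteq> row n T 1 \<union> ?B"
    proof
      fix x assume x: "x \<in> {1..<?b}"
      have "?b \<le> 2 * n"
        using rows b by auto
      then have "x \<in> row n T 1 \<union> row n T 2"
        using rows(1) x by auto
      then show "x \<in> row n T 1 \<union> ?B"
        using x before by (auto simp: row_def)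
    qed
    have "(\<lambda>c. T (1, c)) ` {1..Suc k} \<subseteq> row n T 1 \<inter> {..<?b}"
    proof
      fix x assume "x \<in> (\<lambda>c. T (1, c)) ` {1..Suc k}"
      then obtain c where c: "x = T (1, c)" "c \<in> {1..Suc k}"
        by blast
      then have "c \<in> {1..n}"
        using k by simp
      moreover have "T (1, c) \<le> T (1, Suc k)"
        using SYT_row_less_iff[OF T _ k \<open>c \<in> {1..n}\<close>, of 1] c by (simp add: not_less[symmetric])
      ultimately show "x \<in> row n T 1 \<inter> {..<?b}"
        using SYT_column_less[OF T k] c by (auto simp: row_def)
    qed
    then have "card ((\<lambda>c. T (1, c)) ` {1..Suc k}) \<le> card (row n T 1 \<inter> {..<?b})"
      by (intro card_mono) (simp_all add: row_def)
    moreover have "card ((\<lambda>c. T (1, c)) ` {1..Suc k}) = Suc k"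
      using card_image[OF inj_on_subset[OF inj[of 1]], of "{1..Suc k}"] k by simp
    moreover have "card ?B \<le> k"
      using card_image_le[of "{1..k}" "\<lambda>c. T (2, c)"] by simp
    ultimately show "card ?B < card (row n T 1 \<inter> {..<?b})"
      by simp
  qed
  moreover have "insert ?b ?B = (\<lambda>c. T (2, c)) ` {1..Suc k}"
    by (simp add: atLeastAtMostSuc_conv)
  ultimately show ?case
    by simp
qed

lemma psi_web:
  assumes T: "T \<in> SYT n"
  shows "psi n T \<in> webs n" "openers (psi n T) = row n T 1"
proof -
  have m: "prefix_matching (row n T 1) (row n T 2) (psi n T)"
    using psi_prefix_matching[OF T, of n] by (simp add: psi_def row_def)
  have "card (row n T r) = n" if "r \<in> {1, 2}" for r
    using tableaux_eq_iff[OF SYT_tableaux[OF T]] that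
    unfolding row_def by (subst card_image) (auto intro!: inj_onI simp: cells_def)
  then have "card (row n T 1) = card (row n T 2)"
    by simp
  then show "psi n T \<in> webs n" "openers (psi n T) = row n T 1"
    using prefix_matching_complete[OF m tableaux_rows[OF SYT_tableaux[OF T]]] by auto
qed

section \<open>Distinctness of standard polytabloids\<close>

lemma tabloid_eq_imp_row_eq:
  assumes "tabloid n T = tabloid n T'" "r \<in> {1, 2}"
  shows "row n T r = row n T' r"
proof -
  have "id \<in> Row n T"
    by (simp add: Row_def permutes_id)
  then have "T \<in> tabloid n T"
    unfolding tabloid_def by (rule rev_image_eqI) simp
  then obtain \<sigma> where "\<sigma> \<in> Row n T'" "T = \<sigma> \<circ> T'"
    unfolding assms(1) by (auto simp: tabloid_def)
  moreover have "row n (\<sigma> \<circ> T') r = \<sigma> ` row n T' r"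
    by (simp add: row_def image_image)
  ultimately show ?thesis
    using assms(2) by (auto simp: Row_def)
qed

text \<open>In a standard tableau the first row holds the smaller entry of each column, so a column
  permutation can only increase the sum of the first row. This sum replaces the dominance order on
  tabloids in the triangularity argument below.\<close>

lemma Col_row_sum:
  assumes T: "T \<in> SYT n" and \<sigma>: "\<sigma> \<in> Col n T"
  shows "\<Sum> (row n T 1) \<le> \<Sum> (row n (\<sigma> \<circ> T) 1)"
    and "\<Sum> (row n (\<sigma> \<circ> T) 1) \<le> \<Sum> (row n T 1) \<Longrightarrow> \<sigma> = id"
proof -
  note eq = tableaux_eq_iff[OF SYT_tableaux[OF T]]
  have perm: "\<sigma> permutes {1..2 * n}"
    using \<sigma> by (simp add: Col_def)
  have col: "{\<sigma> (T (1, c)), \<sigma> (T (2, c))} = {T (1, c), T (2, c)}" if "c \<in> {1..n}" for c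
    using \<sigma> that by (auto simp: Col_def column_def)
  have ge: "T (1, c) \<le> \<sigma> (T (1, c))" if "c \<in> {1..n}" for c
    using col[OF that] SYT_column_less[OF T that] by (auto simp: doubleton_eq_iff)
  have inj: "inj_on (\<lambda>c. T (1, c)) {1..n}"
    using eq by (intro inj_onI) (auto simp: cells_def)
  then have "inj_on (\<lambda>c. \<sigma> (T (1, c))) {1..n}"
    using comp_inj_on[OF _ inj_on_subset[OF permutes_inj[OF perm]], of "\<lambda>c. T (1, c)" "{1..n}"]
    by (simp add: comp_def)
  then have sums: "\<Sum> (row n T 1) = (\<Sum>c\<in>{1..n}. T (1, c))"
    "\<Sum> (row n (\<sigma> \<circ> T) 1) = (\<Sum>c\<in>{1..n}. \<sigma> (T (1, c)))"
    unfolding row_def using inj by (simp_all add: sum.reindex)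
  show "\<Sum> (row n T 1) \<le> \<Sum> (row n (\<sigma> \<circ> T) 1)"
    unfolding sums using ge by (rule sum_mono)
  assume le: "\<Sum> (row n (\<sigma> \<circ> T) 1) \<le> \<Sum> (row n T 1)"
  have fix1: "\<sigma> (T (1, c)) = T (1, c)" if "c \<in> {1..n}" for c
  proof (rule ccontr)
    assume "\<sigma> (T (1, c)) \<noteq> T (1, c)"
    then have "T (1, c) < \<sigma> (T (1, c))"
      using ge[OF that] by simp
    then have "(\<Sum>c\<in>{1..n}. T (1, c)) < (\<Sum>c\<in>{1..n}. \<sigma> (T (1, c)))"
      using ge that by (intro sum_strict_mono_ex1) auto
    then show False
      using le sums by simp
  qed
  then have fix2: "\<sigma> (T (2, c)) = T (2, c)" if "c \<in> {1..n}" for c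
    using col[OF that] SYT_column_less[OF T that] that by (auto simp: doubleton_eq_iff)
  show "\<sigma> = id"
  proof
    fix x
    show "\<sigma> x = id x"
    proof (cases "x \<in> {1..2 * n}")
      case True
      then have "x \<in> row n T 1 \<union> row n T 2"
        using tableaux_rows(1)[OF SYT_tableaux[OF T]] by simp
      then show ?thesis
        using fix1 fix2 by (auto simp: row_def)
    next
      case False
      then show ?thesis
        using permutes_not_in[OF perm] by simp
    qed
  qed
qed

lemma polytabloid_support:
  assumes "Poly_Mapping.lookup (polytabloid n T) X \<noteq> 0"
  obtains \<sigma> where "\<sigma> \<in> Col n T" "X = tabloid n (\<sigma> \<circ> T)"
proof -
  have "(\<Sum>\<sigma>\<in>Col n T. Poly_Mapping.lookup
      (Poly_Mapping.single (tabloid n (\<sigma> \<circ> T)) (of_int (sign \<sigma>) :: complex)) X) \<noteq> 0"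
    using assms by (simp add: polytabloid_def lookup_sum)
  then obtain \<sigma> where "\<sigma> \<in> Col n T" "Poly_Mapping.lookup
      (Poly_Mapping.single (tabloid n (\<sigma> \<circ> T)) (of_int (sign \<sigma>) :: complex)) X \<noteq> 0"
    by (rule sum.not_neutral_contains_not_neutral)
  then show thesis
    using that by (auto simp: lookup_single when_def split: if_splits)
qed

lemma polytabloid_leading_coeff:
  assumes T: "T \<in> SYT n"
  shows "Poly_Mapping.lookup (polytabloid n T) (tabloid n T) = 1"
proof -
  let ?f = "\<lambda>\<sigma>. Poly_Mapping.lookup
    (Poly_Mapping.single (tabloid n (\<sigma> \<circ> T)) (of_int (sign \<sigma>) :: complex)) (tabloid n T)"
  have "finite (Col n T)"
    by (rule finite_subset[OF _ finite_permutations[of "{1..2 * n}"]]) (auto simp: Col_def)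
  moreover have "?f \<sigma> = 0" if "\<sigma> \<in> Col n T - {id}" for \<sigma>
  proof -
    have "tabloid n (\<sigma> \<circ> T) \<noteq> tabloid n T"
      using Col_row_sum(2)[OF T, of \<sigma>] tabloid_eq_imp_row_eq[of n "\<sigma> \<circ> T" T 1] that by auto
    then show ?thesis
      by (simp add: lookup_single)
  qed
  moreover have "id \<in> Col n T"
    by (simp add: Col_def permutes_id)
  ultimately have "(\<Sum>\<sigma>\<in>Col n T. ?f \<sigma>) = (\<Sum>\<sigma>\<in>{id}. ?f \<sigma>)"
    by (intro sum.mono_neutral_right) auto
  then show ?thesis
    by (simp add: polytabloid_def lookup_sum sign_id)
qed

text \<open>The tabloid of \<open>T\<close> occurs in \<open>v\<^sub>T\<close> with coefficient 1, and it has the least sum of the first row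
  among the tabloids in \<open>v\<^sub>T\<close>, attained by it alone. Equal polytabloids therefore have the same least
  tabloid, and a standard tableau can be read off from its tabloid.\<close>

lemma polytabloid_inj:
  assumes T: "T \<in> SYT n" and T': "T' \<in> SYT n" and eq: "polytabloid n T = polytabloid n T'"
  shows "T = T'"
proof -
  have half: "\<exists>\<sigma>\<in>Col n T'. row n T 1 = row n (\<sigma> \<circ> T') 1"
    if "T \<in> SYT n" "polytabloid n T = polytabloid n T'" for T T'
  proof -
    have "Poly_Mapping.lookup (polytabloid n T') (tabloid n T) \<noteq> 0"
      using polytabloid_leading_coeff[OF that(1)] that(2) by simp
    then obtain \<sigma> where "\<sigma> \<in> Col n T'" "tabloid n T = tabloid n (\<sigma> \<circ> T')"
      by (rule polytabloid_support)
    then show ?thesis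
      using tabloid_eq_imp_row_eq by blast
  qed
  obtain \<sigma> where \<sigma>: "\<sigma> \<in> Col n T'" "row n T 1 = row n (\<sigma> \<circ> T') 1"
    using half[OF T eq] by blast
  obtain \<tau> where \<tau>: "\<tau> \<in> Col n T" "row n T' 1 = row n (\<tau> \<circ> T) 1"
    using half[OF T' eq[symmetric]] by blast
  have "\<Sum> (row n (\<sigma> \<circ> T') 1) \<le> \<Sum> (row n T' 1)"
    using Col_row_sum(1)[OF T \<tau>(1)] \<sigma>(2) \<tau>(2) by simp
  then have "\<sigma> = id"
    by (rule Col_row_sum(2)[OF T' \<sigma>(1)])
  then show ?thesis
    using SYT_eqI[OF T T'] \<sigma>(2) by simp
qed

section \<open>The support of \<open>phi\<close>\<close>

text \<open>A nonzero coefficient forces a nonzero coordinate. As \<open>free.representation\<close> is constantly 0 for a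
  dependent family, the standard polytabloids are then independent, and the coordinates of a member
  of the family are those of a basis vector.\<close>

lemma phi_polytabloid_support:
  assumes T': "T' \<in> SYT n" and nz: "Poly_Mapping.lookup (phi n (polytabloid n T')) v \<noteq> 0"
  shows "Poly_Mapping.lookup (phi_value n T') v \<noteq> 0"
proof -
  let ?rep = "free.representation (polytabloid n ` SYT n) (polytabloid n T')"
  have "polytabloid n T' \<in> specht n"
    unfolding specht_def using SYT_tableaux[OF T'] by (intro free.span_base) blast
  then have "(\<Sum>T\<in>SYT n. ?rep (polytabloid n T) * Poly_Mapping.lookup (phi_value n T) v) \<noteq> 0"
    using nz by (simp add: phi_def lookup_sum)
  then obtain T where T: "T \<in> SYT n"
    "?rep (polytabloid n T) * Poly_Mapping.lookup (phi_value n T) v \<noteq> 0"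
    by (rule sum.not_neutral_contains_not_neutral)
  have "free.independent (polytabloid n ` SYT n)"
    using T(2) by (cases "free.dependent (polytabloid n ` SYT n)") (auto simp: free.representation_def)
  then have "?rep (polytabloid n T) = (if polytabloid n T = polytabloid n T' then 1 else 0)"
    using free.representation_basis[of "polytabloid n ` SYT n" "polytabloid n T'"] T' by simp
  then have "polytabloid n T = polytabloid n T'"
    using T(2) by (auto split: if_splits)
  then have "T = T'"
    using polytabloid_inj T(1) T' by blast
  then show ?thesis
    using T(2) by simp
qed

theorem theorem5p7:
  fixes n :: nat and T' :: tableau and v :: web
  assumes "n \<ge> 1"
    and "T' \<in> SYT n"
    and "v \<in> webs n"
    and "Poly_Mapping.lookup (phi n (polytabloid n T')) v \<noteq> 0"
  shows "web_le n v (psi n T')"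
proof -
  define ks where "ks = (SOME ks. tableau_path n (T0 n) ks T')"
  have path: "tableau_path n (T0 n) ks T'"
    unfolding ks_def using tableau_path_exists[OF assms(2)] by (rule someI_ex)
  have "v \<in> Poly_Mapping.keys (word_act ks (Poly_Mapping.single (w0 n) 1))"
    using phi_polytabloid_support[OF assms(2,4)] by (simp add: phi_value_def ks_def in_keys_iff)
  moreover have "\<forall>u\<in>Poly_Mapping.keys (Poly_Mapping.single (w0 n) (1::complex)).
      u \<in> webs n \<and> dominated (openers u) (row n (T0 n) 1)"
    by (simp add: w0_web openers_w0 dominated_refl)
  ultimately have "dominated (openers v) (row n T' 1)"
    using keys_word_act[OF path] by blast
  then show ?thesis
    using dominated_imp_web_le[OF psi_web(1)[OF assms(2)] assms(3)] psi_web(2)[OF assms(2)] by simp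
qed

end
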